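(* Let $X=\Gamma\backslash G$ be the Sawai and Yamada generalized manifold, of complex dimension $2m+1$, described in the context, and consider its small deformations $\{J_t\}_{t\in B}$, $B\subset\mathbb{C}$ a ball centred at $0$, induced by $t\,\frac{\partial}{\partial z}\otimes e^{k_1z}\,\bar y_{2,1}\in H^{0,1}(X;T^{1,0}X)$. Then, for every sufficiently small $t\neq 0$, $$\dim H^{1,0}_{\overline{\partial}_t}(X)=0\qquad\text{and}\qquad \dim H^{2m+1,0}_{\overline{\partial}_t}(X)=0,$$ where $H^{\bullet,\bullet}_{\overline{\partial}_t}(X)$ denotes the Dolbeault cohomology of $(X,J_t)$.
   Context: Let $\mathfrak{n}$ be a complex nilpotent Lie algebra with a basis $Y_1,\dots,Y_\ell,Y_{\ell+1},\dots,Y_m$ such that $[\mathfrak{n},\mathfrak{n}]=\mathbb{C}\langle Y_{\ell+1},\dots,Y_m\rangle$ and $[Y_i,Y_j]=\sum_k C_{ij}^kY_k$ with $C_{ij}^k\in\mathbb{Z}$. Let $\tilde{\mathfrak{n}}=\mathbb{C}\langle Y_{1,1},\dots,Y_{1,m}\rangle\oplus\mathbb{C}\langle Y_{2,1},\dots,Y_{2,m}\rangle$ be the direct sum of two copies of $\mathfrak{n}$ (with $Y_{1,j}$ and $Y_{2,j}$ corresponding to $Y_j$), and let $\mathfrak{g}=\mathbb{C}\langle X_0\rangle\ltimes\tilde{\mathfrak{n}}$ with $[X_0,Y_{1,j}]=k_jY_{1,j}$ and $[X_0,Y_{2,j}]=-k_jY_{2,j}$, where $k_1,\dots,k_m$ are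 positive integers such that the Jacobi identity holds. Let $G=\mathbb{C}\ltimes\tilde N$ be the connected simply-connected complex Lie group with Lie algebra $\mathfrak{g}$, where $\tilde N=N\times N$ and $N$ is the connected simply-connected complex nilpotent Lie group with Lie algebra $\mathfrak{n}$, and let $z$ be the coordinate on the factor $\mathbb{C}$. Using the same global holomorphic coordinates on both copies of $N$ (those of Sawai-Yamada), in which $z\in\mathbb{C}$ acts by $w_{1,j}\mapsto e^{k_jz}w_{1,j}$, $w_{2,j}\mapsto e^{-k_jz}w_{2,j}$, write elements of $G$ as $\left(z,\binom{w_{1,1}}{w_{2,1}},\dots,\binom{w_{1,m}}{w_{2,m}}\right)$ with $z,w_{1,j},w_{2,j}\in\mathbb{C}$. Take $B_0\in SL(2,\mathbb{Z})$ with distinct positive eigenvalues $\lambda,\lambda^{-1}$, put $a=\log\lambda$, and let $$\Gamma=\left\{\left(as+2\pi\sqrt{-1}\,r,\binom{w_{1,1}+\lambda w_{2,1}}{w_{1,1}+\lambda^{-1}w_{2,1}},\dots,\binom{w_{1,m}+\lambda w_{2,m}}{w_{1,m}+\lambda^{-1}w_{2,m}}\right): s,r\in\mathbb{Z},\ w_{1,j},w_{2,j}\in\mathbb{Z}+\sqrt{-1}\,\mathbb{Z}\right\}.$$ By a theorem of Sawai and Yamada (in their coordinates), $\Gamma$ is a lattice in $G$; thus $\Gamma=(a\mathbb{Z}+2\pi\sqrt{-1}\,\mathbb{Z})\ltimes\Gamma''$ with $\Gamma''$ a lattice in $\tilde N$. $X=\Gamma\backslash G$ is the Sawai and Yamada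 generalized manifold, with the complex structure $J_0$ induced from $G$. Let $y_{1,1},\dots,y_{1,m},y_{2,1},\dots,y_{2,m}$ be the basis of left-invariant $(1,0)$-forms on $\tilde N$ dual to $Y_{1,1},\dots,Y_{1,m},Y_{2,1},\dots,Y_{2,m}$ (so $dy_{1,j}=dy_{2,j}=0$ for $1\le j\le\ell$). The left-invariant $(1,0)$-forms on $G$ are spanned by $dz$, $e^{-k_jz}y_{1,j}$, $e^{k_jz}y_{2,j}$, $1\le j\le m$. The form $e^{k_1z}\bar y_{2,1}$ descends to $X$. The deformed complex structure $J_t$ is the one whose $(1,0)$-forms are spanned (over smooth functions) by $dz-t\,e^{k_1z}\,\bar y_{2,1}$, $e^{-k_jz}y_{1,j}$ and $e^{k_jz}y_{2,j}$, $1\le j\le m$. *)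

theory Defs
  imports "HOL-Analysis.Analysis" "HOL-Algebra.Coset" "HOL-Combinatorics.Permutations"
    "HOL-Library.Function_Algebras" "HOL-Library.Extended_Nat"
begin

section \<open>Smooth and holomorphic maps\<close>

primrec C_n :: "nat \<Rightarrow> ('a::euclidean_space \<Rightarrow> 'b::real_normed_vector) \<Rightarrow> bool" where
  "C_n 0 f \<longleftrightarrow> continuous_on UNIV f"
| "C_n (Suc n) f \<longleftrightarrow> (\<forall>x. f differentiable (at x)) \<and>
     (\<forall>v. C_n n (\<lambda>x. frechet_derivative f (at x) v))"

definition smooth :: "('a::euclidean_space \<Rightarrow> 'b::real_normed_vector) \<Rightarrow> bool" where
  "smooth f \<longleftrightarrow> (\<forall>n. C_n n f)"

definition holomorphic_map :: "(complex^'m \<Rightarrow> complex^'n) \<Rightarrow> bool" where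
  "holomorphic_map f \<longleftrightarrow> smooth f \<and>
     (\<forall>x c v. frechet_derivative f (at x) (c *s v) = c *s frechet_derivative f (at x) v)"


section \<open>Nilpotent Lie algebras given by structure constants\<close>

text \<open>A Lie algebra with basis $(Y_i)$ is identified with its coordinate space, $Y_i$ being
  \<^term>\<open>axis i 1\<close>; the structure constant $C_{ij}^k$ is \<^term>\<open>C i j k\<close>.
  Both brackets below are bilinear by construction, so that \<open>lie_bracket\<close> only has to
  require alternation and the Jacobi identity.\<close>

definition n_bracket :: "('n \<Rightarrow> 'n \<Rightarrow> 'n \<Rightarrow> int) \<Rightarrow> complex^'n \<Rightarrow> complex^'n \<Rightarrow> complex^'n::finite" where
  "n_bracket C u v = (\<chi> k. \<Sum>i\<in>UNIV. \<Sum>j\<in>UNIV. of_int (C i j k) * u$i * v$j)"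

text \<open>The bracket of $\mathbb{C}\langle X_0\rangle \ltimes (\mathfrak{n}\oplus\mathfrak{n})$, with
  $[X_0,Y_{1,j}] = k_j Y_{1,j}$ and $[X_0,Y_{2,j}] = -k_j Y_{2,j}$.\<close>

definition g_bracket ::
  "('n \<Rightarrow> 'n \<Rightarrow> 'n \<Rightarrow> int) \<Rightarrow> ('n \<Rightarrow> nat) \<Rightarrow> complex \<times> (complex^'n) \<times> (complex^'n) \<Rightarrow>
    complex \<times> (complex^'n) \<times> (complex^'n) \<Rightarrow> complex \<times> (complex^'n) \<times> (complex^'n::finite)" where
  "g_bracket C k = (\<lambda>(x, u1, u2) (x', u1', u2').
     (0,
      n_bracket C u1 u1' + (\<chi> j. of_nat (k j) * (x * u1'$j - x' * u1$j)),
      n_bracket C u2 u2' - (\<chi> j. of_nat (k j) * (x * u2'$j - x' * u2$j))))"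

definition lie_bracket :: "('a::ab_group_add \<Rightarrow> 'a \<Rightarrow> 'a) \<Rightarrow> bool" where
  "lie_bracket br \<longleftrightarrow> (\<forall>x. br x x = 0) \<and>
     (\<forall>x y z. br x (br y z) + br y (br z x) + br z (br x y) = 0)"

primrec lower_central :: "(complex^'n \<Rightarrow> complex^'n \<Rightarrow> complex^'n) \<Rightarrow> nat \<Rightarrow> (complex^'n) set" where
  "lower_central br 0 = UNIV"
| "lower_central br (Suc n) = vec.span {br x y | x y. y \<in> lower_central br n}"

definition nilpotent_bracket :: "(complex^'n \<Rightarrow> complex^'n \<Rightarrow> complex^'n) \<Rightarrow> bool" where
  "nilpotent_bracket br \<longleftrightarrow> (\<exists>n. lower_central br n = {0})"

definition derived_algebra :: "(complex^'n \<Rightarrow> complex^'n \<Rightarrow> complex^'n) \<Rightarrow> (complex^'n) set" where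
  "derived_algebra br = vec.span {br x y | x y. True}"


section \<open>Complex Lie groups in global coordinates\<close>

text \<open>A complex Lie group with global holomorphic coordinates is a group structure on the whole
  coordinate space; connectedness and simple connectedness are then automatic.
  Multiplication is jointly smooth and holomorphic in each factor, hence jointly holomorphic.\<close>

definition complex_lie_group :: "(complex^'n) monoid \<Rightarrow> bool" where
  "complex_lie_group N \<longleftrightarrow> Group.group N \<and> carrier N = UNIV \<and>
     smooth (\<lambda>(g, h). g \<otimes>\<^bsub>N\<^esub> h) \<and>
     (\<forall>g. holomorphic_map (\<lambda>h. g \<otimes>\<^bsub>N\<^esub> h)) \<and>
     (\<forall>h. holomorphic_map (\<lambda>g. g \<otimes>\<^bsub>N\<^esub> h)) \<and>
     holomorphic_map (\<lambda>g. inv\<^bsub>N\<^esub> g)"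

definition left_invariant_field :: "(complex^'n) monoid \<Rightarrow> complex^'n \<Rightarrow> complex^'n \<Rightarrow> complex^'n" where
  "left_invariant_field N u g = frechet_derivative (\<lambda>h. g \<otimes>\<^bsub>N\<^esub> h) (at \<one>\<^bsub>N\<^esub>) u"

definition field_bracket ::
  "(complex^'n \<Rightarrow> complex^'n) \<Rightarrow> (complex^'n \<Rightarrow> complex^'n) \<Rightarrow> complex^'n \<Rightarrow> complex^'n" where
  "field_bracket V W p = frechet_derivative W (at p) (V p) - frechet_derivative V (at p) (W p)"

text \<open>The tangent vectors \<open>b i\<close> at the identity form a basis, and the left-invariant fields
  extending them satisfy $[Y_i,Y_j]=\sum_k C_{ij}^k Y_k$.\<close>

definition has_lie_algebra ::
  "(complex^'n) monoid \<Rightarrow> ('n \<Rightarrow> complex^'n) \<Rightarrow> ('n \<Rightarrow> 'n \<Rightarrow> 'n \<Rightarrow> int) \<Rightarrow> bool" where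
  "has_lie_algebra N b C \<longleftrightarrow> inj b \<and> vec.independent (range b) \<and> vec.span (range b) = UNIV \<and>
     (\<forall>i j p. field_bracket (left_invariant_field N (b i)) (left_invariant_field N (b j)) p =
        (\<Sum>k\<in>UNIV. of_int (C i j k) *s left_invariant_field N (b k) p))"

definition dual_form :: "(complex^'n) monoid \<Rightarrow> ('n \<Rightarrow> complex^'n) \<Rightarrow> 'n \<Rightarrow> complex^'n \<Rightarrow> complex^'n \<Rightarrow> complex" where
  "dual_form N b j p = (THE f. Vector_Spaces.linear (*s) (*) f \<and>
     (\<forall>i. f (left_invariant_field N (b i) p) = (if i = j then 1 else 0)))"

text \<open>A lattice is a discrete subgroup with compact quotient. The quotient topology on the set of
  right cosets is the unique topology making the projection a quotient map.\<close>

definition lattice_in :: "'a::topological_space set \<Rightarrow> ('a, 'b) monoid_scheme \<Rightarrow> bool" where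
  "lattice_in \<Gamma> G \<longleftrightarrow> subgroup \<Gamma> G \<and> discrete \<Gamma> \<and>
     (\<exists>T. quotient_map (top_of_set (carrier G)) T (\<lambda>g. \<Gamma> #>\<^bsub>G\<^esub> g) \<and> compact_space T)"


section \<open>Complex-valued differential forms\<close>

text \<open>A complex-valued alternating \<open>k\<close>-form on a real vector space is a function of sequences of
  vectors that only depends on the first \<open>k\<close> entries.\<close>

definition alternating_form :: "nat \<Rightarrow> ((nat \<Rightarrow> 'e::real_vector) \<Rightarrow> complex) \<Rightarrow> bool" where
  "alternating_form k \<alpha> \<longleftrightarrow>
     (\<forall>u v. (\<forall>i<k. u i = v i) \<longrightarrow> \<alpha> u = \<alpha> v) \<and>
     (\<forall>v. \<forall>i<k. linear (\<lambda>x. \<alpha> (v(i := x)))) \<and>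
     (\<forall>v. \<forall>i<k. \<forall>j<k. i \<noteq> j \<and> v i = v j \<longrightarrow> \<alpha> v = 0)"

type_synonym 'e form = "'e \<Rightarrow> (nat \<Rightarrow> 'e) \<Rightarrow> complex"

definition smooth_form :: "nat \<Rightarrow> 'e::euclidean_space form \<Rightarrow> bool" where
  "smooth_form k \<omega> \<longleftrightarrow> (\<forall>p. alternating_form k (\<omega> p)) \<and> (\<forall>v. smooth (\<lambda>p. \<omega> p v))"

definition pullback :: "('e::euclidean_space \<Rightarrow> 'e) \<Rightarrow> 'e form \<Rightarrow> 'e form" where
  "pullback \<phi> \<omega> p v = \<omega> (\<phi> p) (\<lambda>i. frechet_derivative \<phi> (at p) (v i))"

text \<open>The usual formula for $d\omega(v_0,\dots,v_k)$ on constant vector fields.\<close>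

definition ext_deriv :: "nat \<Rightarrow> 'e::euclidean_space form \<Rightarrow> 'e form" where
  "ext_deriv k \<omega> p v =
     (\<Sum>i\<le>k. (-1)^i * frechet_derivative (\<lambda>q. \<omega> q (\<lambda>j. if j < i then v j else v (Suc j))) (at p) (v i))"

definition wedge :: "nat \<Rightarrow> (nat \<Rightarrow> 'e \<Rightarrow> complex) \<Rightarrow> (nat \<Rightarrow> 'e) \<Rightarrow> complex" where
  "wedge k \<alpha> v = (\<Sum>\<sigma> | \<sigma> permutes {..<k}. of_int (sign \<sigma>) * (\<Prod>i<k. \<alpha> i (v (\<sigma> i))))"

text \<open>The forms on the quotient $\Gamma\backslash G$ are the forms on \<open>G\<close> invariant under left
  translation by \<open>\<Gamma>\<close>.\<close>

definition quotient_forms :: "'e::euclidean_space monoid \<Rightarrow> 'e set \<Rightarrow> nat \<Rightarrow> 'e form set" where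
  "quotient_forms G \<Gamma> k =
     {\<omega>. smooth_form k \<omega> \<and> (\<forall>\<gamma>\<in>\<Gamma>. pullback (\<lambda>g. \<gamma> \<otimes>\<^bsub>G\<^esub> g) \<omega> = \<omega>)}"


section \<open>Types and Dolbeault cohomology\<close>

global_interpretation cfun: vector_space "\<lambda>(c::complex) (f::'a \<Rightarrow> complex) x. c * f x"
  defines cspan = cfun.span
  by unfold_locales (auto simp: fun_eq_iff algebra_simps)

definition forms10 :: "('e::real_vector \<Rightarrow> 'e) \<Rightarrow> ('e \<Rightarrow> complex) set" where
  "forms10 J = {\<alpha>. linear \<alpha> \<and> (\<forall>v. \<alpha> (J v) = \<i> * \<alpha> v)}"

definition Lambda_pq :: "('e::real_vector \<Rightarrow> 'e) \<Rightarrow> nat \<Rightarrow> nat \<Rightarrow> ((nat \<Rightarrow> 'e) \<Rightarrow> complex) set" where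
  "Lambda_pq J p q = cspan {wedge (p + q) (\<lambda>i. if i < p then \<alpha> i else (\<lambda>v. cnj (\<alpha> i v))) | \<alpha>.
     \<forall>i<p + q. \<alpha> i \<in> forms10 J}"

definition pq_forms ::
  "'e::euclidean_space monoid \<Rightarrow> 'e set \<Rightarrow> ('e \<Rightarrow> 'e \<Rightarrow> 'e) \<Rightarrow> nat \<Rightarrow> nat \<Rightarrow> 'e form set" where
  "pq_forms G \<Gamma> J p q = {\<omega> \<in> quotient_forms G \<Gamma> (p + q). \<forall>x. \<omega> x \<in> Lambda_pq (J x) p q}"

text \<open>\<open>is_dbar G \<Gamma> J p q \<omega> \<eta>\<close> says that $\eta$ is $\overline{\partial}\omega$, the component of type
  $(p,q+1)$ of $d\omega$, for a form $\omega$ of type $(p,q)$.\<close>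

definition is_dbar ::
  "'e::euclidean_space monoid \<Rightarrow> 'e set \<Rightarrow> ('e \<Rightarrow> 'e \<Rightarrow> 'e) \<Rightarrow> nat \<Rightarrow> nat \<Rightarrow> 'e form \<Rightarrow> 'e form \<Rightarrow> bool" where
  "is_dbar G \<Gamma> J p q \<omega> \<eta> \<longleftrightarrow> \<eta> \<in> pq_forms G \<Gamma> J p (Suc q) \<and>
     (\<forall>x. (\<lambda>v. ext_deriv (p + q) \<omega> x v - \<eta> x v) \<in>
        cspan (\<Union>{Lambda_pq (J x) r s | r s. r + s = p + q + 1 \<and> (r, s) \<noteq> (p, Suc q)}))"

definition dbar_cocycles ::
  "'e::euclidean_space monoid \<Rightarrow> 'e set \<Rightarrow> ('e \<Rightarrow> 'e \<Rightarrow> 'e) \<Rightarrow> nat \<Rightarrow> nat \<Rightarrow> 'e form set" where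
  "dbar_cocycles G \<Gamma> J p q = {\<omega> \<in> pq_forms G \<Gamma> J p q. is_dbar G \<Gamma> J p q \<omega> (\<lambda>x v. 0)}"

definition dbar_coboundaries ::
  "'e::euclidean_space monoid \<Rightarrow> 'e set \<Rightarrow> ('e \<Rightarrow> 'e \<Rightarrow> 'e) \<Rightarrow> nat \<Rightarrow> nat \<Rightarrow> 'e form set" where
  "dbar_coboundaries G \<Gamma> J p q = (case q of
     0 \<Rightarrow> {\<lambda>x v. 0}
   | Suc q' \<Rightarrow> {\<eta>. \<exists>\<omega> \<in> pq_forms G \<Gamma> J p q'. is_dbar G \<Gamma> J p q' \<omega> \<eta>})"

text \<open>The dimension of a quotient $Z/B$ of complex vector spaces of forms: the supremum of the
  sizes of the finite families in \<open>Z\<close> that are linearly independent modulo \<open>B\<close>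
  (so it is \<open>\<infinity>\<close>, not \<open>0\<close>, when $Z/B$ is infinite-dimensional).\<close>

definition quotient_dim :: "'e form set \<Rightarrow> 'e form set \<Rightarrow> enat" where
  "quotient_dim Z B = (SUP S \<in> {S. finite S \<and> S \<subseteq> Z \<and>
       (\<forall>c. (\<lambda>x v. \<Sum>\<omega>\<in>S. c \<omega> * \<omega> x v) \<in> B \<longrightarrow> (\<forall>\<omega>\<in>S. c \<omega> = 0))}. enat (card S))"

definition dolbeault_dim ::
  "'e::euclidean_space monoid \<Rightarrow> 'e set \<Rightarrow> ('e \<Rightarrow> 'e \<Rightarrow> 'e) \<Rightarrow> nat \<Rightarrow> nat \<Rightarrow> enat" where
  "dolbeault_dim G \<Gamma> J p q = quotient_dim (dbar_cocycles G \<Gamma> J p q) (dbar_coboundaries G \<Gamma> J p q)"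


section \<open>The Sawai--Yamada manifold and its deformations\<close>

text \<open>The element $(z,\binom{w_{1,1}}{w_{2,1}},\dots,\binom{w_{1,m}}{w_{2,m}})$ of \<open>G\<close> is stored as
  $(z, w_1, w_2)$.\<close>

type_synonym 'n sy = "complex \<times> (complex^'n) \<times> (complex^'n)"

definition scaling :: "('n::finite \<Rightarrow> nat) \<Rightarrow> complex \<Rightarrow> complex^'n \<Rightarrow> complex^'n" where
  "scaling k z w = (\<chi> j. exp (of_nat (k j) * z) * w$j)"

definition sy_group :: "(complex^'n::finite) monoid \<Rightarrow> ('n \<Rightarrow> nat) \<Rightarrow> ('n sy) monoid" where
  "sy_group N k = \<lparr>carrier = UNIV,
     monoid.mult = (\<lambda>(z, w1, w2) (z', w1', w2').
       (z + z', w1 \<otimes>\<^bsub>N\<^esub> scaling k z w1', w2 \<otimes>\<^bsub>N\<^esub> scaling k (- z) w2')),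
     one = (0, \<one>\<^bsub>N\<^esub>, \<one>\<^bsub>N\<^esub>)\<rparr>"

definition gaussian_integers :: "complex set" where
  "gaussian_integers = {of_int x + \<i> * of_int y | x y. True}"

definition sy_lattice :: "real \<Rightarrow> ('n::finite sy) set" where
  "sy_lattice lam =
     {(of_real (ln lam) * of_int s + 2 * of_real pi * \<i> * of_int r,
       \<chi> j. w1$j + of_real lam * w2$j,
       \<chi> j. w1$j + of_real (inverse lam) * w2$j) | s r w1 w2.
      \<forall>j. w1$j \<in> gaussian_integers \<and> w2$j \<in> gaussian_integers}"

text \<open>The forms $dz - t\,e^{k_1 z}\,\overline{y_{2,1}}$, $e^{-k_j z}y_{1,j}$, $e^{k_j z}y_{2,j}$ at a point
  of \<open>G\<close>; the index \<open>i\<^sub>1\<close> plays the role of $1$.\<close>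

definition sy_coframe ::
  "(complex^'n::finite) monoid \<Rightarrow> ('n \<Rightarrow> complex^'n) \<Rightarrow> ('n \<Rightarrow> nat) \<Rightarrow> 'n \<Rightarrow> complex \<Rightarrow> 'n sy \<Rightarrow> ('n sy \<Rightarrow> complex) set" where
  "sy_coframe N b k i\<^sub>1 t = (\<lambda>(z, w1, w2).
     {\<lambda>(\<zeta>, u1, u2). \<zeta> - t * exp (of_nat (k i\<^sub>1) * z) * cnj (dual_form N b i\<^sub>1 w2 u2)}
     \<union> range (\<lambda>j (\<zeta>, u1, u2). exp (- (of_nat (k j) * z)) * dual_form N b j w1 u1)
     \<union> range (\<lambda>j (\<zeta>, u1, u2). exp (of_nat (k j) * z) * dual_form N b j w2 u2))"

text \<open>The complex structure $J_t$, pointwise characterised by its $(1,0)$-forms.\<close>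

definition sy_complex_structure ::
  "(complex^'n::finite) monoid \<Rightarrow> ('n \<Rightarrow> complex^'n) \<Rightarrow> ('n \<Rightarrow> nat) \<Rightarrow> 'n \<Rightarrow> complex \<Rightarrow> 'n sy \<Rightarrow> 'n sy \<Rightarrow> 'n sy" where
  "sy_complex_structure N b k i\<^sub>1 t x =
     (THE J. linear J \<and> (\<forall>v. J (J v) = - v) \<and> forms10 J = cspan (sy_coframe N b k i\<^sub>1 t x))"

definition is_eigenvalue :: "int^2^2 \<Rightarrow> real \<Rightarrow> bool" where
  "is_eigenvalue B x \<longleftrightarrow> (\<exists>v::real^2. v \<noteq> 0 \<and> (\<chi> i j. real_of_int (B$i$j)) *v v = x *s v)"

end

theory Submission
  imports Defs "HOL-Complex_Analysis.Complex_Analysis"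
begin

text \<open>Put $T = t\,e^{k_1 z}$. A form of type $(1,0)$ or $(2m+1,0)$ is described by its coefficients
  \<open>f\<close> in a left-invariant coframe. They are $\Gamma$-invariant, hence bounded because the quotient is
  compact. Being a cocycle means $\partial f/\partial\bar z = 0$ and
  $(\overline{Y}_{2,1} + T\,\partial_z) f = c\,T f$ with $c \neq 0$ a multiple of some $k_j$. By
  Liouville's theorem \<open>f\<close> is independent of \<open>z\<close>, so $\overline{Y}_{2,1} f = c\,T f$ for all \<open>z\<close>,
  which is only possible for \<open>f = 0\<close> since \<open>T\<close> depends on \<open>z\<close>. The two
  differential equations are read off from the contractions of $d\omega$ with one vector of type \<open>(0,1)\<close>
  and otherwise vectors of type \<open>(1,0)\<close>.\<close>

section \<open>Determinants and complexified forms\<close>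

text \<open>The obstacle is that \<open>J\<close> varies with z, so a constant vector does not keep
  its type from point to point. The exterior derivative is nevertheless evaluated on constant
  vectors, where it has no bracket terms, with \<open>J\<close> frozen at the point x. A vector of
  type (0,1) at x fails to be so at nearby points with another z', by a multiple of T z' - T z in
  the z-direction. Differentiating this defect along z gives k_1 T, which is the source of the
  eigenvalue term for the coefficient of the deformed dz and for the top form. For the other
  coefficients of a 1-form the term comes instead from the exponentials in the invariant frame,
  since z is not holomorphic for J_t. Two kinds of coefficients are thus in play: values on constant
  vectors, which enter the differential equations, and values on the invariant frame, which are
  bounded. For the top form both agree, because the frame has determinant 1 in the
  coordinates.\<close>

definition ndet :: "nat \<Rightarrow> (nat \<Rightarrow> nat \<Rightarrow> complex) \<Rightarrow> complex" where
  "ndet n M = (\<Sum>\<sigma> | \<sigma> permutes {..<n}. of_int (sign \<sigma>) * (\<Prod>i<n. M i (\<sigma> i)))"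

lemma wedge_eq_ndet: "wedge n \<alpha> v = ndet n (\<lambda>i j. \<alpha> i (v j))"
  by (simp add: wedge_def ndet_def)

lemma ndet_cong:
  assumes "\<And>i j. i < n \<Longrightarrow> j < n \<Longrightarrow> M i j = M' i j"
  shows "ndet n M = ndet n M'"
  unfolding ndet_def
  by (intro sum.cong refl arg_cong2[where f="(*)"] prod.cong assms)
     (auto dest: permutes_in_image)

lemma ndet_eq_0:
  assumes "\<And>\<sigma>. \<sigma> permutes {..<n} \<Longrightarrow> \<exists>i<n. M i (\<sigma> i) = 0"
  shows "ndet n M = 0"
  unfolding ndet_def
proof (intro sum.neutral ballI)
  fix \<sigma> assume "\<sigma> \<in> {\<sigma>. \<sigma> permutes {..<n}}"
  then obtain i where "i < n" "M i (\<sigma> i) = 0" using assms by auto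
  then have "(\<Prod>i<n. M i (\<sigma> i)) = 0" by auto
  then show "of_int (sign \<sigma>) * (\<Prod>i<n. M i (\<sigma> i)) = 0" by simp
qed

text \<open>A permutation fixing every positive index also fixes 0, so only the identity
  contributes. Row 0 is left arbitrary because it will hold the values of the deformed form dz - T
  ybar, which need not vanish on the other basis vectors.\<close>

lemma ndet_first_row_free:
  assumes "\<And>i j. 0 < i \<Longrightarrow> i < n \<Longrightarrow> j < n \<Longrightarrow> j \<noteq> i \<Longrightarrow> M i j = 0"
  shows "ndet n M = (\<Prod>i<n. M i i)"
proof -
  have "ndet n M = (\<Sum>\<sigma>\<in>{id}. of_int (sign \<sigma>) * (\<Prod>i<n. M i (\<sigma> i)))"
    unfolding ndet_def
  proof (rule sum.mono_neutral_right)
    show "finite {\<sigma>. \<sigma> permutes {..<n}}" by (simp add: finite_permutations)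
    show "{id} \<subseteq> {\<sigma>. \<sigma> permutes {..<n}}" by (simp add: permutes_id)
    show "\<forall>\<sigma>\<in>{\<sigma>. \<sigma> permutes {..<n}} - {id}. of_int (sign \<sigma>) * (\<Prod>i<n. M i (\<sigma> i)) = 0"
    proof
      fix \<sigma> assume "\<sigma> \<in> {\<sigma>. \<sigma> permutes {..<n}} - {id}"
      then have p: "\<sigma> permutes {..<n}" and nid: "\<sigma> \<noteq> id" by auto
      have "\<exists>i. 0 < i \<and> i < n \<and> \<sigma> i \<noteq> i"
      proof (rule ccontr)
        assume *: "\<not> ?thesis"
        have fix': "\<sigma> i = i" if "i \<noteq> 0" for i
          using * p that by (cases "i < n") (auto simp: permutes_def)
        have "\<sigma> 0 = 0"
        proof (rule ccontr)
          assume "\<sigma> 0 \<noteq> 0"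
          then have "\<sigma> (\<sigma> 0) = \<sigma> 0" by (rule fix')
          then show False using inj_eq[OF permutes_inj[OF p], of "\<sigma> 0" 0] \<open>\<sigma> 0 \<noteq> 0\<close> by simp
        qed
        then have "\<sigma> = id" using fix' by (metis eq_id_iff)
        then show False using nid by simp
      qed
      then obtain i where i: "0 < i" "i < n" "\<sigma> i \<noteq> i" by auto
      then have "M i (\<sigma> i) = 0"
        using assms permutes_in_image[OF p, of i] by auto
      then have "(\<Prod>i<n. M i (\<sigma> i)) = 0" using i by auto
      then show "of_int (sign \<sigma>) * (\<Prod>i<n. M i (\<sigma> i)) = 0" by simp
    qed
  qed
  then show ?thesis by (simp add: sign_id)
qed

lemma ndet_permute_rows:
  assumes "\<tau> permutes {..<n}"
  shows "ndet n (\<lambda>i. M (\<tau> i)) = of_int (sign \<tau>) * ndet n M"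
proof -
  have perm: "permutation \<pi>" if "\<pi> permutes {..<n}" for \<pi>
    using that by (rule permutes_imp_permutation[rotated]) simp
  have "ndet n (\<lambda>i. M (\<tau> i)) =
      (\<Sum>\<sigma> | \<sigma> permutes {..<n}. of_int (sign (\<sigma> \<circ> \<tau>)) * (\<Prod>i<n. M (\<tau> i) ((\<sigma> \<circ> \<tau>) i)))"
    unfolding ndet_def by (rule sum_permutations_compose_right[OF assms])
  also have "\<dots> = (\<Sum>\<sigma> | \<sigma> permutes {..<n}. of_int (sign \<tau>) * (of_int (sign \<sigma>) * (\<Prod>i<n. M i (\<sigma> i))))"
  proof (rule sum.cong[OF refl])
    fix \<sigma> assume "\<sigma> \<in> {\<sigma>. \<sigma> permutes {..<n}}"
    then have p: "\<sigma> permutes {..<n}" by simp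
    have "(\<Prod>i<n. M (\<tau> i) ((\<sigma> \<circ> \<tau>) i)) = (\<Prod>i<n. M i (\<sigma> i))"
      using prod.permute[OF assms, of "\<lambda>i. M i (\<sigma> i)"] by (simp add: o_def)
    moreover have "sign (\<sigma> \<circ> \<tau>) = sign \<sigma> * sign \<tau>"
      by (intro sign_compose perm p assms)
    ultimately show "of_int (sign (\<sigma> \<circ> \<tau>)) * (\<Prod>i<n. M (\<tau> i) ((\<sigma> \<circ> \<tau>) i))
        = of_int (sign \<tau>) * (of_int (sign \<sigma>) * (\<Prod>i<n. M i (\<sigma> i)))" by simp
  qed
  finally show ?thesis by (simp add: ndet_def sum_distrib_left)
qed

lemma ndet_equal_rows:
  assumes "i < n" "j < n" "i \<noteq> j" "M i = M j"
  shows "ndet n M = 0"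
proof -
  have "Transposition.transpose i j permutes {..<n}" using assms by (intro permutes_swap_id) auto
  from ndet_permute_rows[OF this, of M] have "ndet n (\<lambda>l. M (Transposition.transpose i j l)) = - ndet n M"
    using assms by (simp add: sign_swap_id)
  moreover have "(\<lambda>l. M (Transposition.transpose i j l)) = M"
    using assms by (auto simp: Transposition.transpose_def fun_eq_iff)
  ultimately show ?thesis by simp
qed

text \<open>Expanding each row over all index functions \<open>f\<close> leaves determinants of
  \<open>Q\<close> with rows chosen by \<open>f\<close>. Repeated rows kill the non-injective
  \<open>f\<close>, and the injective ones are permutations, each contributing its sign.\<close>

lemma ndet_mult: "ndet n (\<lambda>i j. \<Sum>k<n. P i k * Q k j) = ndet n P * ndet n Q"
proof -
  let ?F = "{..<n} \<rightarrow>\<^sub>E {..<n}"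
  have "ndet n (\<lambda>i j. \<Sum>k<n. P i k * Q k j)
      = (\<Sum>\<sigma> | \<sigma> permutes {..<n}. of_int (sign \<sigma>) * (\<Sum>f\<in>?F. \<Prod>i<n. P i (f i) * Q (f i) (\<sigma> i)))"
    unfolding ndet_def by (simp add: prod_sum_PiE)
  also have "\<dots> = (\<Sum>f\<in>?F. (\<Prod>i<n. P i (f i)) * ndet n (\<lambda>i. Q (f i)))"
    unfolding ndet_def sum_distrib_left prod.distrib
    by (subst sum.swap, rule sum.cong[OF refl], rule sum.cong[OF refl], rule mult.left_commute)
  also have "\<dots> = (\<Sum>f\<in>{f\<in>?F. inj_on f {..<n}}. (\<Prod>i<n. P i (f i)) * ndet n (\<lambda>i. Q (f i)))"
  proof (rule sum.mono_neutral_right)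
    show "\<forall>f\<in>?F - {f\<in>?F. inj_on f {..<n}}. (\<Prod>i<n. P i (f i)) * ndet n (\<lambda>i. Q (f i)) = 0"
    proof
      fix f assume "f \<in> ?F - {f\<in>?F. inj_on f {..<n}}"
      then obtain i j where "i < n" "j < n" "i \<noteq> j" "f i = f j" by (auto simp: inj_on_def)
      then have "ndet n (\<lambda>i. Q (f i)) = 0" by (intro ndet_equal_rows[of i n j]) auto
      then show "(\<Prod>i<n. P i (f i)) * ndet n (\<lambda>i. Q (f i)) = 0" by simp
    qed
  qed (auto intro: finite_PiE)
  also have "\<dots> = (\<Sum>\<sigma> | \<sigma> permutes {..<n}. (\<Prod>i<n. P i (\<sigma> i)) * ndet n (\<lambda>i. Q (\<sigma> i)))"
  proof (rule sum.reindex_bij_witness[where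
        i = "\<lambda>\<sigma>. restrict \<sigma> {..<n}" and j = "\<lambda>f i. if i < n then f i else i"])
    fix f assume f: "f \<in> {f\<in>?F. inj_on f {..<n}}"
    then have "f ` {..<n} \<subseteq> {..<n}" by auto
    then have "f ` {..<n} = {..<n}" using f by (intro card_subset_eq) (auto simp: card_image)
    then have "bij_betw f {..<n} {..<n}" using f by (auto simp: bij_betw_def)
    then have "bij_betw (\<lambda>i. if i < n then f i else i) {..<n} {..<n}"
      by (rule bij_betw_cong[THEN iffD1, rotated]) auto
    then show "(\<lambda>i. if i < n then f i else i) \<in> {\<sigma>. \<sigma> permutes {..<n}}"
      by (intro CollectI bij_imp_permutes) auto
    show "restrict (\<lambda>i. if i < n then f i else i) {..<n} = f"
      using f by (auto simp: fun_eq_iff restrict_def PiE_def extensional_def)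
    show "(\<Prod>i<n. P i (if i < n then f i else i)) * ndet n (\<lambda>i. Q (if i < n then f i else i))
        = (\<Prod>i<n. P i (f i)) * ndet n (\<lambda>i. Q (f i))"
      by (intro arg_cong2[where f="(*)"] prod.cong ndet_cong) auto
  next
    fix \<sigma> assume "\<sigma> \<in> {\<sigma>. \<sigma> permutes {..<n}}"
    then have p: "\<sigma> permutes {..<n}" by simp
    show "(\<lambda>i. if i < n then restrict \<sigma> {..<n} i else i) = \<sigma>"
      using p by (auto simp: fun_eq_iff permutes_def)
    show "restrict \<sigma> {..<n} \<in> {f\<in>?F. inj_on f {..<n}}"
      using permutes_in_image[OF p] permutes_inj_on[OF p] by auto
  qed
  also have "\<dots> = (\<Sum>\<sigma> | \<sigma> permutes {..<n}. (\<Prod>i<n. P i (\<sigma> i)) * (of_int (sign \<sigma>) * ndet n Q))"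
    by (rule sum.cong[OF refl]) (simp only: mem_Collect_eq ndet_permute_rows[where M=Q])
  also have "\<dots> = ndet n P * ndet n Q"
    unfolding ndet_def[of n P] sum_distrib_right by (rule sum.cong[OF refl]) simp
  finally show ?thesis .
qed

text \<open>The value on $(a_0+\mathrm{i}b_0,\dots,a_{n-1}+\mathrm{i}b_{n-1})$ of the complex multilinear
  extension of an \<open>n\<close>-form.\<close>

definition complexified ::
  "nat \<Rightarrow> ((nat \<Rightarrow> 'e) \<Rightarrow> complex) \<Rightarrow> (nat \<Rightarrow> 'e) \<Rightarrow> (nat \<Rightarrow> 'e) \<Rightarrow> complex" where
  "complexified n \<eta> a b = (\<Sum>S\<in>Pow {..<n}. \<i> ^ card S * \<eta> (\<lambda>j. if j \<in> S then b j else a j))"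

text \<open>Each summand of the determinant is multiplied out after reindexing its product by the
  argument j instead of the form i. The set \<open>S\<close> then records the arguments that
  contribute their imaginary part.\<close>

lemma complexified_wedge:
  "complexified n (wedge n \<alpha>) a b = ndet n (\<lambda>i j. \<alpha> i (a j) + \<i> * \<alpha> i (b j))"
proof -
  have *: "(\<Prod>i<n. \<alpha> i (a (\<sigma> i)) + \<i> * \<alpha> i (b (\<sigma> i))) =
      (\<Sum>S\<in>Pow {..<n}. \<i> ^ card S * (\<Prod>i<n. \<alpha> i (if \<sigma> i \<in> S then b (\<sigma> i) else a (\<sigma> i))))"
    if p: "\<sigma> permutes {..<n}" for \<sigma>
  proof -
    define \<tau> where "\<tau> = inv_into UNIV \<sigma>"
    have unpermute: "(\<Prod>i<n. F i (\<sigma> i)) = (\<Prod>j<n. F (\<tau> j) j)" for F :: "nat \<Rightarrow> nat \<Rightarrow> complex"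
      using prod.permute[OF permutes_inv[OF p], of "\<lambda>i. F i (\<sigma> i)"]
      by (simp add: o_def \<tau>_def permutes_inverses[OF p])
    have "(\<Prod>i<n. \<alpha> i (a (\<sigma> i)) + \<i> * \<alpha> i (b (\<sigma> i)))
        = (\<Prod>j<n. \<i> * \<alpha> (\<tau> j) (b j) + \<alpha> (\<tau> j) (a j))"
      using unpermute[of "\<lambda>i j. \<alpha> i (a j) + \<i> * \<alpha> i (b j)"] by (simp add: add.commute)
    also have "\<dots> = (\<Sum>S\<in>Pow {..<n}. (\<Prod>j\<in>S. \<i> * \<alpha> (\<tau> j) (b j)) * (\<Prod>j\<in>{..<n} - S. \<alpha> (\<tau> j) (a j)))"
      by (rule prod_add) simp
    also have "\<dots> = (\<Sum>S\<in>Pow {..<n}. \<i> ^ card S * (\<Prod>j<n. \<alpha> (\<tau> j) (if j \<in> S then b j else a j)))"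
    proof (rule sum.cong[OF refl])
      fix S assume "S \<in> Pow {..<n}"
      then have S: "S \<subseteq> {..<n}" by simp
      have "(\<Prod>j<n. \<alpha> (\<tau> j) (if j \<in> S then b j else a j)) =
          (\<Prod>j\<in>{..<n} - S. \<alpha> (\<tau> j) (if j \<in> S then b j else a j)) *
          (\<Prod>j\<in>S. \<alpha> (\<tau> j) (if j \<in> S then b j else a j))"
        by (rule prod.subset_diff[OF S]) simp
      also have "\<dots> = (\<Prod>j\<in>{..<n} - S. \<alpha> (\<tau> j) (a j)) * (\<Prod>j\<in>S. \<alpha> (\<tau> j) (b j))"
        by (intro arg_cong2[where f="(*)"] prod.cong) auto
      finally show "(\<Prod>j\<in>S. \<i> * \<alpha> (\<tau> j) (b j)) * (\<Prod>j\<in>{..<n} - S. \<alpha> (\<tau> j) (a j))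
          = \<i> ^ card S * (\<Prod>j<n. \<alpha> (\<tau> j) (if j \<in> S then b j else a j))"
        by (simp add: prod.distrib)
    qed
    also have "\<dots> = (\<Sum>S\<in>Pow {..<n}. \<i> ^ card S * (\<Prod>i<n. \<alpha> i (if \<sigma> i \<in> S then b (\<sigma> i) else a (\<sigma> i))))"
      by (rule sum.cong[OF refl], subst unpermute, rule refl)
    finally show ?thesis .
  qed
  have "ndet n (\<lambda>i j. \<alpha> i (a j) + \<i> * \<alpha> i (b j)) = (\<Sum>\<sigma> | \<sigma> permutes {..<n}. of_int (sign \<sigma>) *
      (\<Sum>S\<in>Pow {..<n}. \<i> ^ card S * (\<Prod>i<n. \<alpha> i (if \<sigma> i \<in> S then b (\<sigma> i) else a (\<sigma> i)))))"
    unfolding ndet_def by (intro sum.cong refl) (simp add: *)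
  also have "\<dots> = complexified n (wedge n \<alpha>) a b"
    unfolding complexified_def wedge_def sum_distrib_left
    by (subst sum.swap, rule sum.cong[OF refl], rule sum.cong[OF refl], rule mult.left_commute)
  finally show ?thesis by simp
qed

lemma complexified_scale: "complexified n (\<lambda>v. c * \<eta> v) a b = c * complexified n \<eta> a b"
  unfolding complexified_def sum_distrib_left
  by (rule sum.cong[OF refl], rule mult.left_commute)

lemma complexified_span_eq_0:
  assumes "\<eta> \<in> cspan S" "\<And>\<xi>. \<xi> \<in> S \<Longrightarrow> complexified n \<xi> a b = 0"
  shows "complexified n \<eta> a b = 0"
  using assms(1)
proof (induction rule: cfun.span_induct)
  case base
  show ?case
    by (rule cfun.subspaceI)
      (simp_all add: complexified_def algebra_simps sum.distrib flip: sum_distrib_left)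
qed (use assms(2) in auto)

text \<open>The first argument a + \<i> J a is killed by every (1,0)-form, the others a - \<i> J a
  by every conjugate of one. Excluding type (p,1) leaves s = 0 or s \<ge> 2. If s = 0, the row
  matched with column 0 is a (1,0)-form; if s \<ge> 2, two rows are conjugates and one of them is
  matched with a later column. Either way every permutation term has a zero factor.\<close>

lemma complexified_type_eq_0:
  assumes \<eta>: "\<eta> \<in> cspan (\<Union>{Lambda_pq J r s | r s. r + s = Suc p \<and> (r, s) \<noteq> (p, 1)})"
    and b: "b 0 = J (a 0)" "\<And>j. 0 < j \<Longrightarrow> j \<le> p \<Longrightarrow> b j = - J (a j)"
  shows "complexified (Suc p) \<eta> a b = 0"
proof (rule complexified_span_eq_0[OF \<eta>])
  fix \<xi> assume "\<xi> \<in> \<Union>{Lambda_pq J r s | r s. r + s = Suc p \<and> (r, s) \<noteq> (p, 1)}"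
  then obtain r s where rs: "r + s = Suc p" "(r, s) \<noteq> (p, 1)" and \<xi>: "\<xi> \<in> Lambda_pq J r s"
    by auto
  show "complexified (Suc p) \<xi> a b = 0"
  proof (rule complexified_span_eq_0[OF \<xi>[unfolded Lambda_pq_def]])
    fix \<zeta> assume "\<zeta> \<in> {wedge (r + s) (\<lambda>i. if i < r then \<alpha> i else (\<lambda>v. cnj (\<alpha> i v))) | \<alpha>.
      \<forall>i<r + s. \<alpha> i \<in> forms10 J}"
    then obtain \<alpha> where \<zeta>: "\<zeta> = wedge (Suc p) (\<lambda>i. if i < r then \<alpha> i else (\<lambda>v. cnj (\<alpha> i v)))"
      and \<alpha>: "\<And>i. i < Suc p \<Longrightarrow> \<alpha> i \<in> forms10 J" using rs by auto
    have lin: "linear (\<alpha> i)" and J: "\<alpha> i (J v) = \<i> * \<alpha> i v" if "i < Suc p" for i v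
      using \<alpha>[OF that] by (auto simp: forms10_def)
    have "ndet (Suc p) (\<lambda>i j. (if i < r then \<alpha> i else (\<lambda>v. cnj (\<alpha> i v))) (a j) +
        \<i> * (if i < r then \<alpha> i else (\<lambda>v. cnj (\<alpha> i v))) (b j)) = 0"
    proof (rule ndet_eq_0)
      fix \<sigma> assume p: "\<sigma> permutes {..<Suc p}"
      show "\<exists>i<Suc p. (if i < r then \<alpha> i else (\<lambda>v. cnj (\<alpha> i v))) (a (\<sigma> i)) +
        \<i> * (if i < r then \<alpha> i else (\<lambda>v. cnj (\<alpha> i v))) (b (\<sigma> i)) = 0"
      proof (cases "s = 0")
        case True
        define i where "i = inv_into UNIV \<sigma> 0"
        have "\<sigma> i = 0" "i < Suc p"
          using permutes_inverses[OF p] permutes_in_image[OF permutes_inv[OF p], of 0]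
          by (auto simp: i_def)
        then show ?thesis using True rs J b(1) by (intro exI[of _ i]) auto
      next
        case False
        then have "Suc r < Suc p" using rs by auto
        moreover have "\<sigma> r \<noteq> \<sigma> (Suc r)"
          using inj_eq[OF permutes_inj[OF p], of r "Suc r"] by simp
        ultimately obtain i where i: "r \<le> i" "i < Suc p" "\<sigma> i \<noteq> 0"
          by (cases "\<sigma> r = 0") (auto intro: that[of r] that[of "Suc r"])
        then have "\<sigma> i \<le> p" using permutes_in_image[OF p, of i] by auto
        then show ?thesis using i J[of i] b(2)[of "\<sigma> i"] linear_neg[OF lin[of i]]
          by (intro exI[of _ i]) (auto simp: algebra_simps)
      qed
    qed
    then show "complexified (Suc p) \<zeta> a b = 0" by (simp add: \<zeta> complexified_wedge)
  qed
qed

text \<open>The increasing enumeration of the indices other than \<open>i\<close>, that is, the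
  omission of an argument in \<open>ext_deriv\<close> written as a composition.\<close>

definition skip :: "nat \<Rightarrow> nat \<Rightarrow> nat" where
  "skip i j = (if j < i then j else Suc j)"

lemma inj_skip: "inj (skip i)"
  by (auto simp: inj_def skip_def split: if_splits)

lemma skip_neq: "skip i j \<noteq> i"
  by (auto simp: skip_def)

lemma insert_skip_image:
  assumes "i \<le> p"
  shows "{..<Suc p} = insert i (skip i ` {..<p})"
proof (intro equalityI subsetI)
  fix x assume x: "x \<in> {..<Suc p}"
  consider "x < i" | "x = i" | "i < x" by linarith
  then show "x \<in> insert i (skip i ` {..<p})"
  proof cases
    case 1
    then have "x = skip i x" "x < p" using assms by (auto simp: skip_def)
    then show ?thesis by blast
  next
    case 3
    then have "x = skip i (x - 1)" "x - 1 < p" using x by (auto simp: skip_def)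
    then show ?thesis by blast
  qed simp
qed (use assms in \<open>auto simp: skip_def\<close>)

text \<open>The exterior derivative commutes with complex multilinear extension: the complex vector
  in the distinguished slot i becomes a complex direction of differentiation, while the other slots
  are absorbed into \<open>complexified\<close> one degree lower.\<close>

lemma complexified_ext_deriv:
  fixes \<omega> :: "'e::euclidean_space form"
  assumes diff: "\<And>v. (\<lambda>q. \<omega> q v) differentiable (at x)"
  shows "complexified (Suc p) (ext_deriv p \<omega> x) a b =
    (\<Sum>i\<le>p. (-1)^i *
      (frechet_derivative (\<lambda>q. complexified p (\<omega> q) (a \<circ> skip i) (b \<circ> skip i)) (at x) (a i) +
       \<i> * frechet_derivative (\<lambda>q. complexified p (\<omega> q) (a \<circ> skip i) (b \<circ> skip i)) (at x) (b i)))"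
proof -
  define D where "D v = frechet_derivative (\<lambda>q. \<omega> q v) (at x)" for v
  define V where "V S j = (if j \<in> S then b j else a j)" for S j
  have D: "((\<lambda>q. \<omega> q v) has_derivative D v) (at x)" for v
    unfolding D_def using diff frechet_derivative_works by blast
  have fd: "frechet_derivative (\<lambda>q. complexified p (\<omega> q) (a \<circ> skip i) (b \<circ> skip i)) (at x)
      = (\<lambda>u. \<Sum>S\<in>Pow {..<p}. \<i> ^ card S * D (\<lambda>j. if j \<in> S then b (skip i j) else a (skip i j)) u)" for i
    unfolding complexified_def o_def
    by (rule frechet_derivative_at[symmetric]) (auto intro!: derivative_eq_intros D)
  have main: "(\<Sum>S\<in>Pow {..<Suc p}. \<i> ^ card S * D (V S \<circ> skip i) (V S i)) =
      (\<Sum>S\<in>Pow {..<p}. \<i> ^ card S * D (\<lambda>j. if j \<in> S then b (skip i j) else a (skip i j)) (a i)) +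
      \<i> * (\<Sum>S\<in>Pow {..<p}. \<i> ^ card S * D (\<lambda>j. if j \<in> S then b (skip i j) else a (skip i j)) (b i))"
    if i: "i \<le> p" for i
  proof -
    let ?A = "skip i ` {..<p}"
    let ?g = "\<lambda>S. \<i> ^ card S * D (V S \<circ> skip i) (V S i)"
    have notin: "i \<notin> ?A" by (auto simp: skip_neq[symmetric])
    have Pow_A: "Pow ?A = (`) (skip i) ` Pow {..<p}"
      by (rule image_Pow_surj[OF refl, symmetric])
    have inj: "inj_on ((`) (skip i)) (Pow {..<p})"
      by (rule inj_on_image) (rule inj_on_subset[OF inj_skip], simp)
    \<comment> \<open>The subsets are split by whether they contain i. Those containing it
      differentiate along \<open>b i\<close> and have one more element, which accounts for the extra
      factor \<i>.\<close>
    have "sum ?g (Pow {..<Suc p}) = sum ?g (Pow ?A) + sum ?g (insert i ` Pow ?A)"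
      unfolding insert_skip_image[OF i] Pow_insert using notin
      by (intro sum.union_disjoint) auto
    also have "sum ?g (insert i ` Pow ?A) = (\<Sum>S\<in>Pow ?A. ?g (insert i S))"
      by (rule sum.reindex_cong[OF _ refl refl]) (use notin in \<open>blast intro: inj_onI dest: insert_ident[THEN iffD1, rotated 2]\<close>)
    also have "(\<Sum>S\<in>Pow ?A. ?g (insert i S)) = (\<Sum>S\<in>Pow {..<p}. ?g (insert i (skip i ` S)))"
      unfolding Pow_A by (rule sum.reindex_cong[OF inj refl refl])
    also have "sum ?g (Pow ?A) = (\<Sum>S\<in>Pow {..<p}. ?g (skip i ` S))"
      unfolding Pow_A by (rule sum.reindex_cong[OF inj refl refl])
    also have "(\<Sum>S\<in>Pow {..<p}. ?g (insert i (skip i ` S))) =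
        \<i> * (\<Sum>S\<in>Pow {..<p}. \<i> ^ card S * D (\<lambda>j. if j \<in> S then b (skip i j) else a (skip i j)) (b i))"
      unfolding sum_distrib_left
    proof (rule sum.cong[OF refl])
      fix S assume "S \<in> Pow {..<p}"
      then have fin: "finite (skip i ` S)" and "i \<notin> skip i ` S"
        using notin by (auto intro: finite_subset)
      then have "card (insert i (skip i ` S)) = Suc (card S)"
        by (simp add: card_image inj_on_subset[OF inj_skip])
      moreover have "V (insert i (skip i ` S)) \<circ> skip i = (\<lambda>j. if j \<in> S then b (skip i j) else a (skip i j))"
        by (auto simp: V_def fun_eq_iff skip_neq inj_image_mem_iff[OF inj_skip])
      ultimately show "?g (insert i (skip i ` S)) = \<i> * (\<i> ^ card S *
          D (\<lambda>j. if j \<in> S then b (skip i j) else a (skip i j)) (b i))"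
        by (simp add: V_def)
    qed
    also have "(\<Sum>S\<in>Pow {..<p}. ?g (skip i ` S)) =
        (\<Sum>S\<in>Pow {..<p}. \<i> ^ card S * D (\<lambda>j. if j \<in> S then b (skip i j) else a (skip i j)) (a i))"
    proof (rule sum.cong[OF refl])
      fix S assume "S \<in> Pow {..<p}"
      then have "V (skip i ` S) i = a i" using notin by (auto simp: V_def)
      moreover have "card (skip i ` S) = card S"
        by (simp add: card_image inj_on_subset[OF inj_skip])
      moreover have "V (skip i ` S) \<circ> skip i = (\<lambda>j. if j \<in> S then b (skip i j) else a (skip i j))"
        by (auto simp: V_def fun_eq_iff inj_image_mem_iff[OF inj_skip])
      ultimately show "?g (skip i ` S) = \<i> ^ card S *
          D (\<lambda>j. if j \<in> S then b (skip i j) else a (skip i j)) (a i)"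
        by simp
    qed
    finally show ?thesis .
  qed
  have "complexified (Suc p) (ext_deriv p \<omega> x) a b =
      (\<Sum>S\<in>Pow {..<Suc p}. \<Sum>i\<le>p. (-1)^i * (\<i> ^ card S * D (V S \<circ> skip i) (V S i)))"
  proof -
    have omit: "V S \<circ> skip i = (\<lambda>j. if j < i then V S j else V S (Suc j))" for S i
      by (auto simp: skip_def fun_eq_iff)
    have "ext_deriv p \<omega> x (V S) = (\<Sum>i\<le>p. (-1)^i * D (V S \<circ> skip i) (V S i))" for S
      unfolding omit ext_deriv_def D_def ..
    then show ?thesis
      unfolding complexified_def V_def[symmetric, abs_def]
      by (simp add: sum_distrib_left mult_ac)
  qed
  also have "\<dots> = (\<Sum>i\<le>p. (-1)^i * (\<Sum>S\<in>Pow {..<Suc p}. \<i> ^ card S * D (V S \<circ> skip i) (V S i)))"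
    by (subst sum.swap) (simp add: sum_distrib_left)
  also have "\<dots> = (\<Sum>i\<le>p. (-1)^i *
      (frechet_derivative (\<lambda>q. complexified p (\<omega> q) (a \<circ> skip i) (b \<circ> skip i)) (at x) (a i) +
       \<i> * frechet_derivative (\<lambda>q. complexified p (\<omega> q) (a \<circ> skip i) (b \<circ> skip i)) (at x) (b i)))"
    by (intro sum.cong refl) (simp add: main fd)
  finally show ?thesis .
qed

section \<open>Calculus\<close>

lemma quotient_dim_eq_0:
  assumes "\<And>\<omega>. \<omega> \<in> Z \<Longrightarrow> \<omega> = (\<lambda>x v. 0)"
  shows "quotient_dim Z {\<lambda>x v. 0} = 0"
proof -
  have "S = {}" if "finite S" "S \<subseteq> Z"
    and indep: "\<forall>c. (\<lambda>x v. \<Sum>\<omega>\<in>S. c \<omega> * \<omega> x v) \<in> {\<lambda>x v. 0} \<longrightarrow> (\<forall>\<omega>\<in>S. c \<omega> = 0)" for S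
  proof -
    \<comment> \<open>All coefficients equal to 1 give a zero combination, so independence forces
      \<open>S\<close> to be empty.\<close>
    have "(\<lambda>x v. \<Sum>\<omega>\<in>S. (1::complex) * \<omega> x v) = (\<lambda>x v. 0)"
      using assms that(2) by (fastforce simp: fun_eq_iff intro!: sum.neutral)
    then show ?thesis using indep[rule_format, of "\<lambda>_. 1"] by auto
  qed
  then have "{S. finite S \<and> S \<subseteq> Z \<and> (\<forall>c. (\<lambda>x v. \<Sum>\<omega>\<in>S. c \<omega> * \<omega> x v) \<in> {\<lambda>x v. 0} \<longrightarrow>
      (\<forall>\<omega>\<in>S. c \<omega> = 0))} \<subseteq> {{}}"
    by blast
  then have "quotient_dim Z {\<lambda>x v. 0} \<le> 0"
    unfolding quotient_dim_def by (intro SUP_least) (auto simp: zero_enat_def)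
  then show ?thesis by simp
qed

text \<open>The quotient is available only as an abstract topology \<open>T\<close> on cosets. Since
  \<open>f\<close> is constant on cosets, it lifts along the quotient map to a continuous function
  on a compact space with the same range.\<close>

lemma lattice_invariant_bounded:
  fixes f :: "'a::topological_space \<Rightarrow> 'b::metric_space"
  assumes lattice: "lattice_in \<Gamma> G" and carrier: "carrier G = UNIV"
    and one: "\<And>x. \<one>\<^bsub>G\<^esub> \<otimes>\<^bsub>G\<^esub> x = x"
    and inv: "\<And>\<gamma> x. \<gamma> \<in> \<Gamma> \<Longrightarrow> f (\<gamma> \<otimes>\<^bsub>G\<^esub> x) = f x"
    and cont: "continuous_on UNIV f"
  shows "bounded (range f)"
proof -
  obtain T where sub: "subgroup \<Gamma> G" and T: "compact_space T"
    and q: "quotient_map (top_of_set UNIV) T (\<lambda>g. \<Gamma> #>\<^bsub>G\<^esub> g)"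
    using lattice carrier by (auto simp: lattice_in_def)
  have const: "f x = f y" if eq: "\<Gamma> #>\<^bsub>G\<^esub> x = \<Gamma> #>\<^bsub>G\<^esub> y" for x y
  proof -
    have "x \<in> \<Gamma> #>\<^bsub>G\<^esub> x"
      using subgroup.one_closed[OF sub] one[of x] by (force simp: r_coset_def)
    then obtain \<gamma> where "\<gamma> \<in> \<Gamma>" "x = \<gamma> \<otimes>\<^bsub>G\<^esub> y" unfolding eq by (auto simp: r_coset_def)
    then show ?thesis by (simp add: inv)
  qed
  obtain g where g: "continuous_map T euclidean g" "g ` topspace T = f ` topspace (top_of_set UNIV)"
  proof (rule quotient_map_lift_exists[OF q, of euclidean f])
    show "continuous_map (top_of_set UNIV) euclidean f" using cont by simp
  qed (use const in blast)+
  have "compactin euclidean (g ` topspace T)"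
    using T g(1) by (intro image_compactin) (auto simp: compact_space_def)
  then have "compact (range f)" using g(2) by simp
  then show ?thesis by (rule compact_imp_bounded)
qed

section \<open>Directional derivatives, their symmetry, and the Liouville argument\<close>

lemma smooth_differentiable: "smooth f \<Longrightarrow> f differentiable (at x)"
  unfolding smooth_def by (metis C_n.simps(2))

lemma smooth_frechet_derivative: "smooth f \<Longrightarrow> smooth (\<lambda>x. frechet_derivative f (at x) v)"
  unfolding smooth_def by (metis C_n.simps(2))

lemma differentiable_has_derivative:
  "f differentiable (at x) \<Longrightarrow> (f has_derivative frechet_derivative f (at x)) (at x)"
  by (simp add: frechet_derivative_works)

lemma has_vector_derivative_along_line:
  assumes "g differentiable (at (y + s *\<^sub>R c))"
  shows "((\<lambda>s. g (y + s *\<^sub>R c)) has_vector_derivative frechet_derivative g (at (y + s *\<^sub>R c)) c) (at s within S)"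
proof -
  let ?D = "frechet_derivative g (at (y + s *\<^sub>R c))"
  have "((\<lambda>s. g (y + s *\<^sub>R c)) has_derivative (\<lambda>h. ?D (h *\<^sub>R c))) (at s within S)"
    by (rule has_derivative_compose[where f = "\<lambda>s. y + s *\<^sub>R c",
          OF _ differentiable_has_derivative[OF assms]])
       (auto intro!: derivative_eq_intros)
  then show ?thesis
    unfolding has_vector_derivative_def
    by (simp add: linear_cmul[OF linear_frechet_derivative[OF assms]])
qed

text \<open>Symmetry of second derivatives, by integration: the increment of \<open>F\<close> along
  b is the integral of \<open>B\<close>, and differentiating it along a under the integral sign
  expresses the increment of \<open>A\<close> along b as the integral of \<open>g\<close>.
  Differentiating that at 0 gives the claim, which is later applied to the group
  multiplication.\<close>

lemma frechet_derivative_commute: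
  fixes F :: "'a::euclidean_space \<Rightarrow> 'b::euclidean_space"
  assumes F: "smooth F"
  shows "frechet_derivative (\<lambda>x. frechet_derivative F (at x) a) (at x) b =
    frechet_derivative (\<lambda>x. frechet_derivative F (at x) b) (at x) a"
proof -
  define A where "A x = frechet_derivative F (at x) a" for x
  define B where "B x = frechet_derivative F (at x) b" for x
  define g where "g y = frechet_derivative B (at y) a" for y
  have A: "A differentiable (at y)" and B: "B differentiable (at y)" for y
    unfolding A_def B_def by (intro smooth_differentiable smooth_frechet_derivative F)+
  have cont_B: "continuous_on UNIV B"
    using B by (simp add: continuous_at_imp_continuous_on differentiable_imp_continuous_within)
  have "smooth g"
    unfolding g_def B_def by (intro smooth_frechet_derivative F)
  then have cont_g: "continuous_on UNIV g"
    by (simp add: continuous_at_imp_continuous_on differentiable_imp_continuous_within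
        smooth_differentiable)
  have int: "integral {0..t} (\<lambda>r. g (x + r *\<^sub>R b)) = A (x + t *\<^sub>R b) - A x" if t: "0 \<le> t" for t
  proof -
    have FTC: "((\<lambda>r. B (x + s *\<^sub>R a + r *\<^sub>R b)) has_integral
        F (x + s *\<^sub>R a + t *\<^sub>R b) - F (x + s *\<^sub>R a + 0 *\<^sub>R b)) {0..t}" for s
      unfolding B_def
      by (rule fundamental_theorem_of_calculus[OF t])
         (rule has_vector_derivative_along_line[OF smooth_differentiable[OF F]])
    have "((\<lambda>s. integral (cbox 0 t) (\<lambda>r. B (x + s *\<^sub>R a + r *\<^sub>R b))) has_vector_derivative
        integral (cbox 0 t) (\<lambda>r. g (x + 0 *\<^sub>R a + r *\<^sub>R b))) (at 0 within UNIV)"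
    proof (rule leibniz_rule_vector_derivative)
      fix s r :: real
      have "((\<lambda>s. B ((x + r *\<^sub>R b) + s *\<^sub>R a)) has_vector_derivative g ((x + r *\<^sub>R b) + s *\<^sub>R a)) (at s)"
        unfolding g_def by (rule has_vector_derivative_along_line[OF B])
      then show "((\<lambda>s. B (x + s *\<^sub>R a + r *\<^sub>R b)) has_vector_derivative g (x + s *\<^sub>R a + r *\<^sub>R b)) (at s)"
        by (simp add: algebra_simps)
    next
      show "(\<lambda>r. B (x + s *\<^sub>R a + r *\<^sub>R b)) integrable_on cbox 0 t" for s
        using FTC[of s] by (auto simp: has_integral_integrable)
      show "continuous_on (UNIV \<times> cbox 0 t) (\<lambda>(s, r). g (x + s *\<^sub>R a + r *\<^sub>R b))"
        unfolding case_prod_unfold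
        by (intro continuous_on_compose2[OF cont_g] continuous_intros) auto
    qed auto
    moreover have "integral (cbox 0 t) (\<lambda>r. B (x + s *\<^sub>R a + r *\<^sub>R b)) =
        F (x + t *\<^sub>R b + s *\<^sub>R a) - F (x + s *\<^sub>R a)" for s
      using integral_unique[OF FTC[of s]] by (simp add: algebra_simps)
    ultimately have 1: "((\<lambda>s. F (x + t *\<^sub>R b + s *\<^sub>R a) - F (x + s *\<^sub>R a)) has_vector_derivative
        integral {0..t} (\<lambda>r. g (x + r *\<^sub>R b))) (at 0)"
      by simp
    have 2: "((\<lambda>s. F (x + t *\<^sub>R b + s *\<^sub>R a) - F (x + s *\<^sub>R a)) has_vector_derivative
        A (x + t *\<^sub>R b + 0 *\<^sub>R a) - A (x + 0 *\<^sub>R a)) (at 0)"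
      unfolding A_def
      by (intro has_vector_derivative_diff has_vector_derivative_along_line smooth_differentiable F)
    show ?thesis using vector_derivative_unique_at[OF 1 2] by simp
  qed
  \<comment> \<open>The integral formula is known only for nonnegative t, so the derivatives at 0
    are taken within {0..1}, where they are still unique.\<close>
  have "continuous_on {0..1} (\<lambda>r. g (x + r *\<^sub>R b))"
    by (intro continuous_on_compose2[OF cont_g] continuous_intros) auto
  from integral_has_vector_derivative[OF this, of 0]
  have "((\<lambda>t. integral {0..t} (\<lambda>r. g (x + r *\<^sub>R b))) has_vector_derivative g x) (at 0 within {0..1})"
    by simp
  then have 1: "((\<lambda>t. A (x + t *\<^sub>R b) - A x) has_vector_derivative g x) (at 0 within {0..1})"
    by (rule has_vector_derivative_transform[rotated 2]) (auto simp: int)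
  have "((\<lambda>t. A (x + t *\<^sub>R b) - A x) has_vector_derivative
      frechet_derivative A (at (x + 0 *\<^sub>R b)) b - 0) (at 0 within {0..1})"
    by (intro has_vector_derivative_diff has_vector_derivative_along_line has_vector_derivative_const) (use A in auto)
  from vector_derivative_unique_within_closed_interval[unfolded cbox_interval, OF _ _ this 1]
  show ?thesis by (simp add: g_def A_def[abs_def] B_def[abs_def])
qed

lemma linear_complex_apply:
  fixes L :: "complex \<times> 'w::real_vector \<Rightarrow> complex"
  assumes "linear L" "L (\<i>, 0) = \<i> * L (1, 0)"
  shows "L (\<zeta>, 0) = \<zeta> * L (1, 0)"
proof -
  have "(\<zeta>, 0::'w) = Re \<zeta> *\<^sub>R (1, 0) + Im \<zeta> *\<^sub>R (\<i>, 0)"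
    by (auto simp: complex_eq_iff)
  then have "L (\<zeta>, 0) = Re \<zeta> *\<^sub>R L (1, 0) + Im \<zeta> *\<^sub>R L (\<i>, 0)"
    by (simp only: linear_add[OF assms(1)] linear_cmul[OF assms(1)])
  also have "\<dots> = \<zeta> * L (1, 0)"
    by (simp add: assms(2) scaleR_conv_of_real flip: ring_distribs mult.assoc)
       (metis complex_eq mult.commute)
  finally show ?thesis .
qed

text \<open>The two vectors in \<open>eq\<close> stand for u and Ju. For f holomorphic in z their
  first components add up to twice t exp(\<kappa> z) times the z-derivative, which vanishes by
  Liouville. What remains on the left involves only \<open>Y w\<close> and \<open>Y' w\<close>,
  hence is the same for all z, whereas the right side carries the factor exp(\<kappa> z).\<close>

lemma bounded_eigenfunction_vanishes:
  fixes f :: "complex \<times> 'w::euclidean_space \<Rightarrow> complex"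
  assumes diff: "\<And>x. f differentiable (at x)" and bdd: "bounded (range f)"
    and hol: "\<And>x. frechet_derivative f (at x) (\<i>, 0) = \<i> * frechet_derivative f (at x) (1, 0)"
    and eq: "\<And>z w. frechet_derivative f (at (z, w)) (t * exp (\<kappa> * z), Y w) +
        \<i> * frechet_derivative f (at (z, w)) (- \<i> * t * exp (\<kappa> * z), Y' w) = c * (t * exp (\<kappa> * z)) * f (z, w)"
    and nz: "t \<noteq> 0" "c \<noteq> 0" "\<kappa> \<noteq> 0"
  shows "f x = 0"
proof -
  let ?D = "\<lambda>x. frechet_derivative f (at x)"
  note lin = linear_frechet_derivative[OF diff]
  have D: "(f has_derivative ?D x) (at x)" for x
    by (rule differentiable_has_derivative[OF diff])
  have z_deriv: "((\<lambda>z. f (z, w)) has_field_derivative ?D (z, w) (1, 0)) (at z)" for z w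
  proof -
    have "((\<lambda>z. f (z, w)) has_derivative (\<lambda>\<zeta>. ?D (z, w) (\<zeta>, 0))) (at z)"
      by (rule has_derivative_compose[where f = "\<lambda>z. (z, w)", OF _ D]) (auto intro!: derivative_eq_intros)
    moreover have "(\<lambda>\<zeta>. ?D (z, w) (\<zeta>, 0)) = (*) (?D (z, w) (1, 0))"
      by (rule ext, subst linear_complex_apply[OF lin hol]) (rule mult.commute)
    ultimately show ?thesis by (simp add: has_field_derivative_def)
  qed
  have const: "f (z, w) = f (0, w)" for z w
  proof -
    have "(\<lambda>z. f (z, w)) holomorphic_on UNIV"
      using z_deriv by (auto simp: holomorphic_on_def field_differentiable_def)
    moreover have "bounded (range (\<lambda>z. f (z, w)))"
      by (rule bounded_subset[OF bdd]) auto
    ultimately have "(\<lambda>z. f (z, w)) constant_on UNIV"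
      by (rule Liouville_theorem)
    then show ?thesis by (auto simp: constant_on_def)
  qed
  have "?D (z, w) (1, 0) = 0" for z w
  proof -
    have "((\<lambda>z. f (z, w)) has_field_derivative 0) (at z)" by (subst const) simp
    then show ?thesis using z_deriv DERIV_unique by blast
  qed
  then have z0: "?D (z, w) (\<zeta>, 0) = 0" for z w \<zeta>
    by (subst linear_complex_apply[OF lin hol]) simp
  have w_deriv: "?D (z, w) (0, v) = ?D (0, w) (0, v)" for z w v
  proof -
    have "((\<lambda>w. f (z, w)) has_derivative (\<lambda>v. ?D (z, w) (0, v))) (at w)" for z
      by (rule has_derivative_compose[where f = "Pair z", OF _ D]) (auto intro!: derivative_eq_intros)
    from this[of z] this[of 0] have "(\<lambda>v. ?D (z, w) (0, v)) = (\<lambda>v. ?D (0, w) (0, v))"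
      by (subst (asm) const) (rule has_derivative_unique)
    then show ?thesis by (simp add: fun_eq_iff)
  qed
  have split: "?D (z, w) (\<zeta>, v) = ?D (0, w) (0, v)" for z w \<zeta> v
  proof -
    have "?D (z, w) (\<zeta>, v) = ?D (z, w) (\<zeta>, 0) + ?D (z, w) (0, v)"
      using linear_add[OF lin, of "(z, w)" "(\<zeta>, 0)" "(0, v)"] by simp
    then show ?thesis by (simp only: z0 add_0 w_deriv[of z w v])
  qed
  obtain z w where x: "x = (z, w)" by (cases x)
  have *: "?D (0, w) (0, Y w) + \<i> * ?D (0, w) (0, Y' w) = c * (t * exp (\<kappa> * z)) * f (0, w)" for z
    using eq[of z w] unfolding split[of z] const[of z w] .
  \<comment> \<open>The point ln 2 / \<kappa> is chosen so that the exponential is 2; comparison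
    with z = 0 then makes \<open>f (0, w)\<close> proportional to its own double.\<close>
  have "exp (\<kappa> * (of_real (ln 2) / \<kappa>)) = 2"
    using nz exp_of_real[of "ln 2", where 'a=complex] by simp
  moreover have "c * (t * exp (\<kappa> * 0)) * f (0, w) = c * (t * exp (\<kappa> * (of_real (ln 2) / \<kappa>))) * f (0, w)"
    using *[of 0] *[of "of_real (ln 2) / \<kappa>"] by (rule trans[OF sym])
  ultimately have "f (0, w) = 0" using nz by auto
  then show ?thesis using x const[of z w] by simp
qed

section \<open>Left-invariant fields\<close>

lemma complex_smult_decompose: "c *s v = Re c *\<^sub>R v + Im c *\<^sub>R (\<i> *s (v::complex^'n))"
  by (simp add: vec_eq_iff complex_eq_iff)

lemma complex_linearI:
  fixes L :: "complex^'n \<Rightarrow> complex"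
  assumes "linear L" "\<And>v. L (\<i> *s v) = \<i> * L v"
  shows "L (c *s v) = c * L v"
proof -
  have "L (c *s v) = Re c *\<^sub>R L v + Im c *\<^sub>R L (\<i> *s v)"
    by (subst complex_smult_decompose) (simp add: linear_add[OF assms(1)] linear_cmul[OF assms(1)])
  then show ?thesis by (simp add: assms(2) complex_eq_iff)
qed

lemma bounded_linear_smult_right [simp]: "bounded_linear (\<lambda>v::complex^'n. c *s v)"
  by (rule linear_conv_bounded_linear[THEN iffD1])
     (auto intro!: linearI simp: vec_eq_iff algebra_simps)

lemma scaling_0 [simp]: "scaling k 0 w = w"
  by (simp add: scaling_def vec_eq_iff)

lemma scaling_zero [simp]: "scaling k z 0 = 0"
  by (simp add: scaling_def vec_eq_iff)

lemma scaling_smult: "scaling k z (c *s w) = c *s scaling k z w"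
  by (simp add: scaling_def vec_eq_iff)

lemma scaling_axis: "scaling k z (axis j 1) = exp (of_nat (k j) * z) *s axis j 1"
  by (auto simp: scaling_def vec_eq_iff axis_def)

lemma bounded_linear_scaling: "bounded_linear (scaling k z)"
  by (rule linear_conv_bounded_linear[THEN iffD1])
     (auto intro!: linearI simp: scaling_def vec_eq_iff algebra_simps)

lemma frechet_derivative_scaling [simp]: "frechet_derivative (scaling k z) (at x) = scaling k z"
  by (rule frechet_derivative_at[symmetric]) (rule bounded_linear_imp_has_derivative[OF bounded_linear_scaling])

locale sy_structure =
  fixes N :: "(complex^'n::finite) monoid" and b :: "'n \<Rightarrow> complex^'n" and k :: "'n \<Rightarrow> nat"
    and \<Gamma> :: "'n sy set" and i\<^sub>1 :: 'n and t :: complex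
  assumes N: "complex_lie_group N"
    and b: "inj b" "vec.independent (range b)" "vec.span (range b) = UNIV"
    and k_pos: "\<And>j. 0 < k j"
    and scaling_hom: "\<And>z. scaling k z \<in> hom N N"
    and scaling_b: "\<And>z j. scaling k z (b j) = exp (of_nat (k j) * z) *s b j"
    and lattice: "lattice_in \<Gamma> (sy_group N k)"
    and t: "t \<noteq> 0"
begin

abbreviation mul :: "complex^'n \<Rightarrow> complex^'n \<Rightarrow> complex^'n" (infixl "\<cdot>" 70) where
  "g \<cdot> h \<equiv> g \<otimes>\<^bsub>N\<^esub> h"

abbreviation lif :: "complex^'n \<Rightarrow> complex^'n \<Rightarrow> complex^'n" where
  "lif \<equiv> left_invariant_field N"

lemma group_N: "Group.group N" and carrier_N: "carrier N = UNIV"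
  using N by (auto simp: complex_lie_group_def)

lemma mul_assoc: "(g \<cdot> h) \<cdot> l = g \<cdot> (h \<cdot> l)"
  using monoid.m_assoc[OF group.is_monoid[OF group_N]] carrier_N by simp

lemma scaling_mul: "scaling k z (g \<cdot> h) = scaling k z g \<cdot> scaling k z h"
  using scaling_hom[of z] by (simp add: hom_def carrier_N)

text \<open>Every automorphism \<open>scaling k z\<close> fixes the identity, and the weights are
  positive: a parameter for which the j-th factor is 2 forces the j-th coordinate to be 0.\<close>

lemma one_N: "\<one>\<^bsub>N\<^esub> = 0"
proof -
  have "scaling k z \<one>\<^bsub>N\<^esub> = \<one>\<^bsub>N\<^esub>" for z
    using hom_one[OF scaling_hom group_N group_N] .
  then have "exp (of_nat (k j) * z) * \<one>\<^bsub>N\<^esub> $ j = \<one>\<^bsub>N\<^esub> $ j" for z j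
    by (simp add: scaling_def vec_eq_iff)
  then have "exp (of_real (ln 2)) * \<one>\<^bsub>N\<^esub> $ j = \<one>\<^bsub>N\<^esub> $ j" for j
    using k_pos[of j] by (metis nonzero_mult_div_cancel_left of_nat_0_eq_iff less_irrefl times_divide_eq_right)
  then show ?thesis
    using exp_of_real[of "ln 2", where 'a=complex] by (simp add: vec_eq_iff)
qed

lemma mul_0_left [simp]: "0 \<cdot> g = g" and mul_0_right [simp]: "g \<cdot> 0 = g"
  using monoid.l_one[OF group.is_monoid[OF group_N]] monoid.r_one[OF group.is_monoid[OF group_N]]
  by (auto simp: carrier_N one_N)

lemma ex_inverse: "\<exists>g'. g' \<cdot> g = 0 \<and> g \<cdot> g' = 0"
  using group.l_inv_ex[OF group_N] group.r_inv_ex[OF group_N]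
  by (metis UNIV_I carrier_N mul_0_left mul_0_right mul_assoc one_N)

lemma smooth_mul: "smooth (\<lambda>(g, h). g \<cdot> h)"
  using N by (simp add: complex_lie_group_def)

abbreviation D_left :: "complex^'n \<Rightarrow> complex^'n \<Rightarrow> complex^'n \<Rightarrow> complex^'n" where
  "D_left g h \<equiv> frechet_derivative (\<lambda>h. g \<cdot> h) (at h)"

lemma left_mul_has_derivative: "((\<lambda>h. g \<cdot> h) has_derivative D_left g h) (at h)"
  using N by (intro differentiable_has_derivative smooth_differentiable)
    (simp add: complex_lie_group_def holomorphic_map_def)

lemma D_left_smult: "D_left g h (c *s v) = c *s D_left g h v"
  using N by (simp add: complex_lie_group_def holomorphic_map_def)

lemma D_right_smult:
  "frechet_derivative (\<lambda>g. g \<cdot> h) (at g) (c *s v) = c *s frechet_derivative (\<lambda>g. g \<cdot> h) (at g) v"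
  using N by (simp add: complex_lie_group_def holomorphic_map_def)

lemma lif_eq_D_left: "lif u g = D_left g 0 u"
  by (simp add: left_invariant_field_def one_N)

lemma linear_D_left: "linear (D_left g h)"
  by (rule has_derivative_linear[OF left_mul_has_derivative])

lemma lif_smult: "lif (c *s u) g = c *s lif u g"
  by (simp add: lif_eq_D_left D_left_smult)

lemma lif_linear: "linear (\<lambda>u. lif u g)"
  by (simp add: lif_eq_D_left linear_D_left)

lemma D_left_mul: "D_left (g \<cdot> g') h v = D_left g (g' \<cdot> h) (D_left g' h v)"
proof -
  have "((\<lambda>h. g \<cdot> (g' \<cdot> h)) has_derivative (\<lambda>v. D_left g (g' \<cdot> h) (D_left g' h v))) (at h)"
    by (rule has_derivative_compose[OF left_mul_has_derivative left_mul_has_derivative])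
  then show ?thesis
    by (simp add: mul_assoc frechet_derivative_at[symmetric])
qed

lemma D_left_0 [simp]: "D_left 0 h v = v"
  by (simp add: frechet_derivative_ident)

lemma lif_translate: "D_left \<gamma> g (lif u g) = lif u (\<gamma> \<cdot> g)"
  using D_left_mul[of \<gamma> g 0 u] by (simp add: lif_eq_D_left)

lemma lif_at_0 [simp]: "lif u 0 = u"
  by (simp add: lif_eq_D_left)

text \<open>Both sides are derivatives at the identity of the two expressions for
  \<open>scaling k z\<close> applied to a product; this is the naturality of left-invariant fields
  under an automorphism.\<close>

lemma scaling_lif: "scaling k z (lif u g) = lif (scaling k z u) (scaling k z g)"
proof -
  note S = bounded_linear_imp_has_derivative[OF bounded_linear_scaling, of k z]
  have "((\<lambda>h. scaling k z (g \<cdot> h)) has_derivative (\<lambda>v. scaling k z (D_left g 0 v))) (at 0)"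
    by (rule has_derivative_compose[OF left_mul_has_derivative S])
  moreover have "((\<lambda>h. scaling k z g \<cdot> scaling k z h) has_derivative
      (\<lambda>v. D_left (scaling k z g) (scaling k z 0) (scaling k z v))) (at 0)"
    by (rule has_derivative_compose[OF S left_mul_has_derivative])
  ultimately have "scaling k z (D_left g 0 u) = D_left (scaling k z g) (scaling k z 0) (scaling k z u)"
    unfolding scaling_mul by (metis has_derivative_unique)
  then show ?thesis by (simp add: lif_eq_D_left)
qed

lemma lif_scaling: "lif (axis j 1) (scaling k z g) = exp (- of_nat (k j) * z) *s scaling k z (lif (axis j 1) g)"
  by (simp add: scaling_lif scaling_axis lif_smult vec.scale_scale flip: exp_add)

lemma lif_surj: obtains u where "v = lif u g"
proof -
  obtain g' where g': "g' \<cdot> g = 0" "g \<cdot> g' = 0" using ex_inverse by blast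
  have "v = lif (D_left g' g v) g"
    using D_left_mul[of g g' g v] g' by (simp add: lif_eq_D_left)
  then show ?thesis by (rule that)
qed

text \<open>The base point g becomes an argument of a partial derivative of the jointly smooth
  multiplication, from which differentiability of the field in g follows.\<close>

lemma lif_eq_mul_derivative: "lif u g = frechet_derivative (\<lambda>(g, h). g \<cdot> h) (at (g, 0)) (0, u)"
proof -
  have "((\<lambda>h. (\<lambda>(g, h). g \<cdot> h) (g, h)) has_derivative
      (\<lambda>v. frechet_derivative (\<lambda>(g, h). g \<cdot> h) (at (g, 0)) (0, v))) (at 0)"
    by (rule has_derivative_compose[where f = "Pair g",
          OF _ differentiable_has_derivative[OF smooth_differentiable[OF smooth_mul]]])
       (auto intro!: derivative_eq_intros)
  then show ?thesis by (simp add: lif_eq_D_left frechet_derivative_at[symmetric])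
qed

lemma smooth_lif_extension: "smooth (\<lambda>x. frechet_derivative (\<lambda>(g, h). g \<cdot> h) (at x) (0, u))"
  by (rule smooth_frechet_derivative[OF smooth_mul])

lemma lif_has_derivative: "(lif u has_derivative
    (\<lambda>v. frechet_derivative (\<lambda>x. frechet_derivative (\<lambda>(g, h). g \<cdot> h) (at x) (0, u)) (at (g, 0)) (v, 0))) (at g)"
  unfolding lif_eq_mul_derivative
  by (rule has_derivative_compose[where f = "\<lambda>g. (g, 0)",
        OF _ differentiable_has_derivative[OF smooth_differentiable[OF smooth_lif_extension]]])
     (auto intro!: derivative_eq_intros)

text \<open>The fields are holomorphic because the mixed partial derivatives of the multiplication commute.\<close>

lemma lif_holomorphic:
  "frechet_derivative (lif u) (at g) (c *s v) = c *s frechet_derivative (lif u) (at g) v"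
proof -
  let ?m = "\<lambda>(g, h). g \<cdot> h"
  have swap: "frechet_derivative (lif u) (at g) v =
      frechet_derivative (\<lambda>x. frechet_derivative ?m (at x) (v, 0)) (at (g, 0)) (0, u)" for v
    unfolding frechet_derivative_at[OF lif_has_derivative, symmetric]
    by (rule frechet_derivative_commute[OF smooth_mul])
  have "frechet_derivative ?m (at x) (v, 0) = frechet_derivative (\<lambda>g. g \<cdot> snd x) (at (fst x)) v" for x v
  proof -
    have "((\<lambda>g. ?m (g, snd x)) has_derivative (\<lambda>v. frechet_derivative ?m (at (fst x, snd x)) (v, 0))) (at (fst x))"
      by (rule has_derivative_compose[where f = "\<lambda>g. (g, snd x)",
            OF _ differentiable_has_derivative[OF smooth_differentiable[OF smooth_mul]]])
         (auto intro!: derivative_eq_intros)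
    then show ?thesis by (simp add: frechet_derivative_at[symmetric])
  qed
  then have "(\<lambda>x. frechet_derivative ?m (at x) (c *s v, 0)) = (\<lambda>x. c *s frechet_derivative ?m (at x) (v, 0))"
    by (simp add: D_right_smult)
  then show ?thesis
    unfolding swap
    by (simp add: frechet_derivative_at[symmetric, OF bounded_linear.has_derivative[OF bounded_linear_smult_right
          differentiable_has_derivative[OF smooth_differentiable[OF smooth_frechet_derivative[OF smooth_mul]]]]])
qed

end

section \<open>The deformed complex structure\<close>

lemma sum_fun_apply: "(\<Sum>i\<in>A. f i) x = (\<Sum>i\<in>A. f i x :: 'b::comm_monoid_add)"
  by (induction A rule: infinite_finite_induct) (auto simp: zero_fun_def plus_fun_def)

lemma forms10D:
  assumes "\<alpha> \<in> forms10 J"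
  shows "linear \<alpha>" "\<alpha> (J v) = \<i> * \<alpha> v"
  using assms unfolding forms10_def by blast+

lemma forms10_subspace: "cfun.subspace (forms10 J)"
proof (rule cfun.subspaceI)
  show "0 \<in> forms10 J"
    by (simp add: forms10_def module_hom_zero linear_zero zero_fun_def)
  show "\<alpha> + \<beta> \<in> forms10 J" if "\<alpha> \<in> forms10 J" "\<beta> \<in> forms10 J" for \<alpha> \<beta>
    using that linear_compose_add[of \<alpha> \<beta>] by (auto simp: forms10_def algebra_simps plus_fun_def)
  show "(\<lambda>x. c * \<alpha> x) \<in> forms10 J" if "\<alpha> \<in> forms10 J" for c \<alpha>
    using that linear_compose[of \<alpha> "(*) c"]
    by (auto simp: forms10_def o_def algebra_simps intro!: linearI)
qed

context sy_structure
begin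

definition y :: "complex^'n \<Rightarrow> complex^'n \<Rightarrow> complex" where
  "y = dual_form N b i\<^sub>1"

lemma lif_expansion: obtains c where "v = (\<Sum>j\<in>UNIV. c j *s lif (b j) g)"
proof -
  obtain u where u: "v = lif u g" by (rule lif_surj)
  have "u \<in> vec.span (range b)" by (simp add: b)
  then obtain d where "u = (\<Sum>w\<in>range b. d w *s w)"
    by (auto simp: vec.span_finite)
  then have "u = (\<Sum>j\<in>UNIV. d (b j) *s b j)"
    using sum.reindex[OF b(1), of "\<lambda>w. d w *s w"] by (simp add: o_def)
  then have "v = (\<Sum>j\<in>UNIV. d (b j) *s lif (b j) g)"
    by (simp add: u linear_sum[OF lif_linear] lif_smult)
  then show ?thesis by (rule that)
qed

text \<open>These facts show that the definite description in \<open>dual_form\<close> denotes.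
  Existence: the functional dual to \<open>b\<close> at the identity is pulled back by the left
  translation that carries g to the identity. Uniqueness: the fields \<open>lif (b j)\<close> span
  at g.\<close>

lemma
  shows linear_dual_form: "Vector_Spaces.linear (*s) (*) (dual_form N b j g)" (is ?lin)
    and dual_form_lif: "dual_form N b j g (lif (b i) g) = (if i = j then 1 else 0)" (is ?val)
proof -
  interpret vp: vector_space_pair "(*s) :: complex \<Rightarrow> complex^'n \<Rightarrow> _" "(*) :: complex \<Rightarrow> complex \<Rightarrow> complex"
    by unfold_locales (auto simp: algebra_simps)
  let ?P = "\<lambda>f. Vector_Spaces.linear (*s) (*) f \<and>
    (\<forall>i. f (lif (b i) g) = (if i = j then 1 else (0::complex)))"
  obtain f where f: "Vector_Spaces.linear (*s) (*) f" "\<forall>x\<in>range b. f x = (if x = b j then 1 else (0::complex))"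
    using vp.linear_independent_extend[OF b(2), of "\<lambda>x. if x = b j then 1 else 0"] by blast
  obtain g' where g': "g' \<cdot> g = 0" using ex_inverse by blast
  have ex: "?P (\<lambda>v. f (D_left g' g v))"
  proof (intro conjI allI)
    have "Vector_Spaces.linear (*s) (*s) (D_left g' g)"
      by unfold_locales (auto simp: D_left_smult linear_add[OF linear_D_left])
    from Vector_Spaces.linear_compose[OF this f(1)]
    show "Vector_Spaces.linear (*s) (*) (\<lambda>v. f (D_left g' g v))" by (simp add: o_def)
    show "f (D_left g' g (lif (b i) g)) = (if i = j then 1 else 0)" for i
      using f(2) inj_eq[OF b(1)] by (simp add: lif_translate g')
  qed
  have uniq: "f' = f''" if "?P f'" "?P f''" for f' f''
  proof
    fix v
    obtain c where v: "v = (\<Sum>j\<in>UNIV. c j *s lif (b j) g)" by (rule lif_expansion)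
    have val: "f v = (\<Sum>j\<in>UNIV. c j * f (lif (b j) g))" if "Vector_Spaces.linear (*s) (*) f" for f
      by (simp add: v vp.linear_sum[OF that] vp.linear_scale[OF that])
    then show "f' v = f'' v" using that val[of f'] val[of f''] by simp
  qed
  have "\<exists>!f. ?P f" by (rule ex_ex1I, rule exI, rule ex, rule uniq)
  from theI'[OF this] have "?P (dual_form N b j g)"
    unfolding dual_form_def .
  then show ?lin ?val by auto
qed

lemma dual_form_smult: "dual_form N b j g (c *s v) = c * dual_form N b j g v"
  and dual_form_add: "dual_form N b j g (u + v) = dual_form N b j g u + dual_form N b j g v"
  using linear_dual_form[of j g] by (auto simp: Vector_Spaces.linear_iff)

lemma dual_form_real_linear: "linear (dual_form N b j g)"
proof (rule linearI)
  fix r and v :: "complex^'n"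
  have "r *\<^sub>R v = complex_of_real r *s v" by (simp add: vec_eq_iff complex_eq_iff)
  then show "dual_form N b j g (r *\<^sub>R v) = r *\<^sub>R dual_form N b j g v"
    by (simp add: dual_form_smult scaleR_conv_of_real[where 'a=complex])
qed (rule dual_form_add)

lemma dual_form_expansion: "v = (\<Sum>j\<in>UNIV. dual_form N b j g v *s lif (b j) g)"
proof -
  obtain c where v: "v = (\<Sum>j\<in>UNIV. c j *s lif (b j) g)" by (rule lif_expansion)
  have "dual_form N b i g v = c i" for i
    by (simp add: v linear_sum[OF dual_form_real_linear] dual_form_smult dual_form_lif if_distrib cong: if_cong)
  then show ?thesis using v by simp
qed

definition T :: "complex \<Rightarrow> complex" where
  "T z = t * exp (of_nat (k i\<^sub>1) * z)"

text \<open>The z-component is forced by requiring dz - T ybar to be multiplied by \<i>. Since ybar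
  is antilinear, its value changes by -\<i> when u2 is multiplied by \<i>; restoring the correct
  sign costs twice \<i> T ybar.\<close>

definition J :: "'n sy \<Rightarrow> 'n sy \<Rightarrow> 'n sy" where
  "J = (\<lambda>(z, w1, w2) (\<zeta>, u1, u2). (\<i> * \<zeta> - 2 * \<i> * T z * cnj (y w2 u2), \<i> *s u1, \<i> *s u2))"

lemma J_simp: "J (z, w1, w2) (\<zeta>, u1, u2) = (\<i> * \<zeta> - 2 * \<i> * T z * cnj (y w2 u2), \<i> *s u1, \<i> *s u2)"
  by (simp add: J_def)

lemma y_simps: "y g (c *s v) = c * y g v" "y g (u + v) = y g u + y g v" "y g (r *\<^sub>R v) = r *\<^sub>R y g v" "y g 0 = 0"
  using linear_cmul[OF dual_form_real_linear] linear_0[OF dual_form_real_linear]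
  by (auto simp: y_def dual_form_smult dual_form_add)

lemma linear_J: "linear (J x)"
  by (cases x) (auto intro!: linearI simp: J_simp y_simps algebra_simps vec_eq_iff scaleR_conv_of_real[where 'a=complex])

lemma J_J: "J x (J x v) = - v"
  by (cases x; cases v) (auto simp: J_simp y_simps algebra_simps vec_eq_iff)

lemma forms10_J_expansion:
  assumes \<alpha>: "\<alpha> \<in> forms10 (J (z, w1, w2))"
  obtains c A B where "\<And>\<zeta> u1 u2. \<alpha> (\<zeta>, u1, u2) = c * (\<zeta> - T z * cnj (y w2 u2)) + A u1 + B u2"
    "linear A" "linear B" "\<And>c u. A (c *s u) = c * A u" "\<And>c u. B (c *s u) = c * B u"
proof -
  let ?J = "J (z, w1, w2)"
  have lin: "linear \<alpha>" and J: "\<alpha> (?J v) = \<i> * \<alpha> v" for v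
    using forms10D[OF \<alpha>] by blast+
  define c where "c = \<alpha> (1, 0, 0)"
  define A where "A u = \<alpha> (0, u, 0)" for u
  \<comment> \<open>The added term cancels the antilinear part of \<alpha> on the second copy, so
    that \<open>B\<close> is complex linear.\<close>
  define B where "B u = \<alpha> (0, 0, u) + c * T z * cnj (y w2 u)" for u
  have \<zeta>: "\<alpha> (\<zeta>, 0, 0) = c * \<zeta>" for \<zeta>
  proof -
    have "\<alpha> (\<i>, 0, 0) = \<i> * \<alpha> (1, 0, 0)" using J[of "(1, 0, 0)"] by (simp add: J_simp y_simps)
    then show ?thesis using linear_complex_apply[OF lin, of \<zeta>] by (simp add: c_def zero_prod_def)
  qed
  have split: "\<alpha> (\<zeta>, u1, u2) = \<alpha> (\<zeta>, 0, 0) + \<alpha> (0, u1, 0) + \<alpha> (0, 0, u2)" for \<zeta> u1 u2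
    by (simp flip: linear_add[OF lin])
  have lin_A: "linear A"
    unfolding A_def
    by (intro linear_compose[OF _ lin, unfolded o_def] linearI) auto
  have lin_B: "linear B"
  proof (rule linearI)
    show "B (u + v) = B u + B v" for u v
      using linear_add[OF lin, of "(0, 0, u)" "(0, 0, v)"] by (simp add: B_def y_simps algebra_simps)
    show "B (r *\<^sub>R u) = r *\<^sub>R B u" for r u
      using linear_cmul[OF lin, of r "(0, 0, u)"] by (simp add: B_def y_simps algebra_simps scaleR_conv_of_real[where 'a=complex])
  qed
  have A_i: "A (\<i> *s u) = \<i> * A u" for u
    using J[of "(0, u, 0)"] by (simp add: A_def J_simp y_simps)
  have B_i: "B (\<i> *s u) = \<i> * B u" for u
    using J[of "(0, 0, u)"] split[of "- 2 * \<i> * T z * cnj (y w2 u)" 0 "\<i> *s u"] linear_0[OF lin]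
    by (simp add: B_def J_simp y_simps \<zeta> zero_prod_def algebra_simps)
  have "\<alpha> (\<zeta>, u1, u2) = c * (\<zeta> - T z * cnj (y w2 u2)) + A u1 + B u2" for \<zeta> u1 u2
    by (subst split) (simp add: \<zeta> A_def B_def algebra_simps)
  then show ?thesis
    by (rule that[OF _ lin_A lin_B complex_linearI[OF lin_A A_i] complex_linearI[OF lin_B B_i]])
qed

lemma sy_coframe_eq: "sy_coframe N b k i\<^sub>1 t (z, w1, w2) =
     {\<lambda>(\<zeta>, u1, u2). \<zeta> - T z * cnj (y w2 u2)}
     \<union> range (\<lambda>j (\<zeta>, u1, u2). exp (- (of_nat (k j) * z)) * dual_form N b j w1 u1)
     \<union> range (\<lambda>j (\<zeta>, u1, u2). exp (of_nat (k j) * z) * dual_form N b j w2 u2)"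
  by (simp add: sy_coframe_def T_def y_def)

lemma forms10_JI:
  assumes A: "linear A" "\<And>u. A (\<i> *s u) = \<i> * A u" and B: "linear B" "\<And>u. B (\<i> *s u) = \<i> * B u"
  shows "(\<lambda>(\<zeta>, u1, u2). c * (\<zeta> - T z * cnj (y w2 u2)) + A u1 + B u2) \<in> forms10 (J (z, w1, w2))"
    (is "?\<alpha> \<in> _")
  unfolding forms10_def
proof (intro CollectI conjI allI)
  show "linear ?\<alpha>"
  proof (rule linearI)
    show "?\<alpha> (u + v) = ?\<alpha> u + ?\<alpha> v" for u v
      by (cases u; cases v) (simp add: linear_add[OF A(1)] linear_add[OF B(1)] y_simps ring_distribs)
    show "?\<alpha> (r *\<^sub>R u) = r *\<^sub>R ?\<alpha> u" for r u
      by (cases u) (simp add: linear_cmul[OF A(1)] linear_cmul[OF B(1)] y_simps right_diff_distrib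
          scaleR_right_distrib scaleR_right_diff_distrib)
  qed
  show "?\<alpha> (J (z, w1, w2) v) = \<i> * ?\<alpha> v" for v
    by (cases v) (simp add: J_simp y_simps A(2) B(2) algebra_simps)
qed

lemma sy_coframe_forms10: "sy_coframe N b k i\<^sub>1 t x \<subseteq> forms10 (J x)"
proof -
  obtain z w1 w2 where x: "x = (z, w1, w2)" by (cases x)
  note smult = linear_compose[OF dual_form_real_linear, of "(*) c" for c, unfolded o_def]
  have lin: "linear (\<lambda>u. c * dual_form N b j w u)" for c j w
    by (rule smult) (auto intro!: linearI simp: algebra_simps)
  have zero: "linear (\<lambda>u::complex^'n. 0::complex)" by (rule linear_zero)
  show ?thesis
    unfolding x sy_coframe_eq
    using forms10_JI[OF zero _ zero, of 1 z w2 w1]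
      forms10_JI[OF lin _ zero, of "exp (- (of_nat (k j) * z))" j w1 0 z w2 w1 for j]
      forms10_JI[OF zero _ lin, of "exp (of_nat (k j) * z)" j w2 0 z w2 w1 for j]
    by (auto simp: dual_form_smult mult.left_commute)
qed

text \<open>For the nontrivial inclusion the complex linear parts of a (1,0)-form are expanded in
  the dual forms; the exponentials in the coefficients undo those built into the coframe.\<close>

lemma cspan_sy_coframe: "cspan (sy_coframe N b k i\<^sub>1 t x) = forms10 (J x)"
proof
  show "cspan (sy_coframe N b k i\<^sub>1 t x) \<subseteq> forms10 (J x)"
    by (rule cfun.span_minimal[OF sy_coframe_forms10 forms10_subspace])
  show "forms10 (J x) \<subseteq> cspan (sy_coframe N b k i\<^sub>1 t x)"
  proof
    fix \<alpha> assume \<alpha>: "\<alpha> \<in> forms10 (J x)"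
    obtain z w1 w2 where x: "x = (z, w1, w2)" by (cases x)
    obtain c A B where \<alpha>': "\<And>\<zeta> u1 u2. \<alpha> (\<zeta>, u1, u2) = c * (\<zeta> - T z * cnj (y w2 u2)) + A u1 + B u2"
      and A: "linear A" "\<And>c u. A (c *s u) = c * A u" and B: "linear B" "\<And>c u. B (c *s u) = c * B u"
      using forms10_J_expansion[OF \<alpha>[unfolded x]] by metis
    define f0 :: "'n sy \<Rightarrow> complex" where "f0 = (\<lambda>(\<zeta>, u1, u2). \<zeta> - T z * cnj (y w2 u2))"
    define f1 :: "'n \<Rightarrow> 'n sy \<Rightarrow> complex"
      where "f1 = (\<lambda>j (\<zeta>, u1, u2). exp (- (of_nat (k j) * z)) * dual_form N b j w1 u1)"
    define f2 :: "'n \<Rightarrow> 'n sy \<Rightarrow> complex"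
      where "f2 = (\<lambda>j (\<zeta>, u1, u2). exp (of_nat (k j) * z) * dual_form N b j w2 u2)"
    have mem: "f0 \<in> sy_coframe N b k i\<^sub>1 t x" "f1 j \<in> sy_coframe N b k i\<^sub>1 t x" "f2 j \<in> sy_coframe N b k i\<^sub>1 t x" for j
      unfolding x sy_coframe_eq f0_def f1_def f2_def by auto
    have expand: "L u = (\<Sum>j\<in>UNIV. dual_form N b j w u * L (lif (b j) w))"
      if "linear L" "\<And>c u. L (c *s u) = c * L u" for L :: "complex^'n \<Rightarrow> complex" and u w
      using arg_cong[OF dual_form_expansion[of u w], of L] by (simp add: linear_sum[OF that(1)] that(2))
    have "\<alpha> = (\<lambda>v. c * f0 v) + ((\<Sum>j\<in>UNIV. (\<lambda>v. (exp (of_nat (k j) * z) * A (lif (b j) w1)) * f1 j v)) +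
        (\<Sum>j\<in>UNIV. (\<lambda>v. (exp (- (of_nat (k j) * z)) * B (lif (b j) w2)) * f2 j v)))"
    proof
      fix v :: "'n sy"
      obtain \<zeta> u1 u2 where v: "v = (\<zeta>, u1, u2)" by (cases v)
      have "A u1 = (\<Sum>j\<in>UNIV. (exp (of_nat (k j) * z) * A (lif (b j) w1)) * f1 j v)"
        unfolding expand[OF A, of u1 w1] f1_def v
        by (intro sum.cong refl) (simp add: field_simps exp_minus)
      moreover have "B u2 = (\<Sum>j\<in>UNIV. (exp (- (of_nat (k j) * z)) * B (lif (b j) w2)) * f2 j v)"
        unfolding expand[OF B, of u2 w2] f2_def v
        by (intro sum.cong refl) (simp add: field_simps exp_minus)
      ultimately show "\<alpha> v = ((\<lambda>v. c * f0 v) + ((\<Sum>j\<in>UNIV. (\<lambda>v. (exp (of_nat (k j) * z) * A (lif (b j) w1)) * f1 j v)) +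
        (\<Sum>j\<in>UNIV. (\<lambda>v. (exp (- (of_nat (k j) * z)) * B (lif (b j) w2)) * f2 j v)))) v"
        by (simp add: sum_fun_apply v \<alpha>' f0_def)
    qed
    also have "\<dots> \<in> cspan (sy_coframe N b k i\<^sub>1 t x)"
      by (intro cfun.span_add cfun.span_sum cfun.span_scale cfun.span_base mem)
    finally show "\<alpha> \<in> cspan (sy_coframe N b k i\<^sub>1 t x)" .
  qed
qed

text \<open>The coframe separates tangent vectors, so a structure with these (1,0)-forms is
  determined: all candidates send v to the vector on which each coframe form takes \<i> times its
  value at v.\<close>

lemma sy_complex_structure_eq: "sy_complex_structure N b k i\<^sub>1 t = J"
proof
  fix x :: "'n sy"
  obtain z w1 w2 where x: "x = (z, w1, w2)" by (cases x)
  have separate: "v = v'" if "\<And>\<alpha>. \<alpha> \<in> sy_coframe N b k i\<^sub>1 t x \<Longrightarrow> \<alpha> v = \<alpha> v'" for v v'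
  proof -
    obtain \<zeta> u1 u2 \<zeta>' u1' u2' where v: "v = (\<zeta>, u1, u2)" "v' = (\<zeta>', u1', u2')" by (cases v; cases v')
    have "dual_form N b j w1 u1 = dual_form N b j w1 u1'" for j
      using that[of "\<lambda>(\<zeta>, u1, u2). exp (- (of_nat (k j) * z)) * dual_form N b j w1 u1"]
      unfolding x sy_coframe_eq v by auto
    moreover have "dual_form N b j w2 u2 = dual_form N b j w2 u2'" for j
      using that[of "\<lambda>(\<zeta>, u1, u2). exp (of_nat (k j) * z) * dual_form N b j w2 u2"]
      unfolding x sy_coframe_eq v by auto
    ultimately have "u1 = u1'" "u2 = u2'"
      using dual_form_expansion[of u1 w1] dual_form_expansion[of u1' w1]
        dual_form_expansion[of u2 w2] dual_form_expansion[of u2' w2] by simp_all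
    moreover have "\<zeta> - T z * cnj (y w2 u2) = \<zeta>' - T z * cnj (y w2 u2')"
      using that[of "\<lambda>(\<zeta>, u1, u2). \<zeta> - T z * cnj (y w2 u2)"] unfolding x sy_coframe_eq v by auto
    ultimately show ?thesis by (simp add: v)
  qed
  show "sy_complex_structure N b k i\<^sub>1 t x = J x"
    unfolding sy_complex_structure_def
  proof (rule the_equality)
    fix J' assume J': "linear J' \<and> (\<forall>v. J' (J' v) = - v) \<and> forms10 J' = cspan (sy_coframe N b k i\<^sub>1 t x)"
    show "J' = J x"
    proof
      fix v
      show "J' v = J x v"
      proof (rule separate)
        fix \<alpha> assume "\<alpha> \<in> sy_coframe N b k i\<^sub>1 t x"
        then have "\<alpha> \<in> forms10 J'" "\<alpha> \<in> forms10 (J x)"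
          using J' cfun.span_base cspan_sy_coframe by blast+
        then show "\<alpha> (J' v) = \<alpha> (J x v)" by (simp add: forms10D(2))
      qed
    qed
  qed (simp add: linear_J J_J cspan_sy_coframe)
qed

end

section \<open>Contracting cocycles\<close>

lemma linear_axis_expansion:
  fixes L :: "complex^'n \<Rightarrow> complex"
  assumes "linear L" "\<And>v. L (\<i> *s v) = \<i> * L v"
  shows "L u = (\<Sum>i\<in>UNIV. u $ i * L (axis i 1))"
  by (subst basis_expansion[of u, symmetric])
    (simp add: linear_sum[OF assms(1)] complex_linearI[OF assms] del: basis_expansion)

text \<open>The derivative along u + \<i> J u, a (0,1)-vector at x, without the customary factor
  1/2; hence the factors 2 in the equations below. In \<open>del\<close> the vector is u - \<i> J
  u.\<close>

definition dbar :: "('e::euclidean_space \<Rightarrow> 'e \<Rightarrow> 'e) \<Rightarrow> ('e \<Rightarrow> complex) \<Rightarrow> 'e \<Rightarrow> 'e \<Rightarrow> complex" where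
  "dbar J f x u = frechet_derivative f (at x) u + \<i> * frechet_derivative f (at x) (J x u)"

definition del :: "('e::euclidean_space \<Rightarrow> 'e \<Rightarrow> 'e) \<Rightarrow> ('e \<Rightarrow> complex) \<Rightarrow> 'e \<Rightarrow> 'e \<Rightarrow> complex" where
  "del J f x u = frechet_derivative f (at x) u - \<i> * frechet_derivative f (at x) (J x u)"

lemma dbar_mult:
  assumes "f differentiable (at x)" "g differentiable (at x)"
  shows "dbar J (\<lambda>q. f q * g q) x u = dbar J f x u * g x + f x * dbar J g x u"
proof -
  have "frechet_derivative (\<lambda>q. f q * g q) (at x) =
      (\<lambda>h. f x * frechet_derivative g (at x) h + frechet_derivative f (at x) h * g x)"
    by (intro frechet_derivative_at[symmetric] has_derivative_mult differentiable_has_derivative assms)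
  then show ?thesis by (simp add: dbar_def algebra_simps)
qed

lemma dbar_sum:
  assumes "finite S" "\<And>i. i \<in> S \<Longrightarrow> f i differentiable (at x)"
  shows "dbar J (\<lambda>q. \<Sum>i\<in>S. f i q) x u = (\<Sum>i\<in>S. dbar J (f i) x u)"
proof -
  have "frechet_derivative (\<lambda>q. \<Sum>i\<in>S. f i q) (at x) = (\<lambda>h. \<Sum>i\<in>S. frechet_derivative (f i) (at x) h)"
    by (intro frechet_derivative_at[symmetric] has_derivative_sum differentiable_has_derivative assms)
  then show ?thesis by (simp add: dbar_def sum.distrib sum_distrib_left)
qed

lemma dbar_cmult:
  assumes "f differentiable (at x)"
  shows "dbar J (\<lambda>q. c * f q) x u = c * dbar J f x u"
proof -
  have "frechet_derivative (\<lambda>q. c * f q) (at x) = (\<lambda>h. c * frechet_derivative f (at x) h)"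
    by (intro frechet_derivative_at[symmetric] has_derivative_mult_right differentiable_has_derivative assms)
  then show ?thesis by (simp add: dbar_def algebra_simps)
qed

lemma dbar_cocycles_subset: "dbar_cocycles G \<Gamma> J p q \<subseteq> pq_forms G \<Gamma> J p q"
  by (auto simp: dbar_cocycles_def)

lemma pq_forms_smooth: "\<omega> \<in> pq_forms G \<Gamma> J p q \<Longrightarrow> smooth (\<lambda>x. \<omega> x v)"
  by (auto simp: pq_forms_def quotient_forms_def smooth_form_def)

lemma pq_forms_Lambda: "\<omega> \<in> pq_forms G \<Gamma> J p q \<Longrightarrow> \<omega> x \<in> Lambda_pq (J x) p q"
  by (auto simp: pq_forms_def)

lemma pq_forms_invariant:
  assumes "\<omega> \<in> pq_forms G \<Gamma> J p q" "\<gamma> \<in> \<Gamma>"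
  shows "\<omega> (\<gamma> \<otimes>\<^bsub>G\<^esub> x) (\<lambda>i. frechet_derivative (\<lambda>g. \<gamma> \<otimes>\<^bsub>G\<^esub> g) (at x) (v i)) = \<omega> x v"
proof -
  have "pullback (\<lambda>g. \<gamma> \<otimes>\<^bsub>G\<^esub> g) \<omega> = \<omega>"
    using assms by (auto simp: pq_forms_def quotient_forms_def)
  from fun_cong[OF fun_cong[OF this], of x v] show ?thesis by (simp add: pullback_def)
qed

text \<open>A cocycle of type \<open>(p,0)\<close> is contracted with one vector $a_0 + \mathrm{i}Ja_0$ of type \<open>(0,1)\<close>
  and the vectors $a_j - \mathrm{i}Ja_j$ of type \<open>(1,0)\<close>, held constant near \<open>x\<close>.\<close>

lemma cocycle_contraction:
  fixes \<omega> :: "'e::euclidean_space form"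
  assumes \<omega>: "\<omega> \<in> dbar_cocycles G \<Gamma> J p 0"
    and b: "b 0 = J x (a 0)" "\<And>j. 0 < j \<Longrightarrow> b j = - J x (a j)"
  defines "F \<equiv> \<lambda>i q. complexified p (\<omega> q) (a \<circ> skip i) (b \<circ> skip i)"
  shows "dbar J (F 0) x (a 0) + (\<Sum>i = 1..p. (-1)^i * del J (F i) x (a i)) = 0"
proof -
  have pq: "\<omega> \<in> pq_forms G \<Gamma> J p 0" using \<omega> dbar_cocycles_subset by blast
  have diff: "(\<lambda>q. \<omega> q v) differentiable (at x)" for v
    by (rule smooth_differentiable[OF pq_forms_smooth[OF pq]])
  have diff_F: "F i differentiable (at x)" for i
    unfolding F_def complexified_def
    by (intro derivative_intros differentiable_sum diff ballI) (auto intro: derivative_intros diff)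
  have "(\<lambda>v. ext_deriv p \<omega> x v - 0) \<in>
      cspan (\<Union>{Lambda_pq (J x) r s | r s. r + s = Suc p \<and> (r, s) \<noteq> (p, 1)})"
    using \<omega> by (auto simp: dbar_cocycles_def is_dbar_def)
  then have "0 = complexified (Suc p) (ext_deriv p \<omega> x) a b"
    using b by (intro complexified_type_eq_0[symmetric]) auto
  also have "\<dots> = (\<Sum>i\<le>p. (-1)^i * (frechet_derivative (F i) (at x) (a i) + \<i> * frechet_derivative (F i) (at x) (b i)))"
    unfolding F_def by (rule complexified_ext_deriv[OF diff])
  also have "\<dots> = dbar J (F 0) x (a 0) + (\<Sum>i = 1..p. (-1)^i * (frechet_derivative (F i) (at x) (a i) + \<i> * frechet_derivative (F i) (at x) (b i)))"
    by (simp add: atMost_atLeast0 sum.atLeast_Suc_atMost dbar_def b)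
  also have "(\<Sum>i = 1..p. (-1)^i * (frechet_derivative (F i) (at x) (a i) + \<i> * frechet_derivative (F i) (at x) (b i)))
      = (\<Sum>i = 1..p. (-1)^i * del J (F i) x (a i))"
    by (intro sum.cong refl) (simp add: del_def b linear_neg[OF linear_frechet_derivative[OF diff_F]])
  finally show ?thesis by simp
qed

lemma type_1_0_form:
  fixes J :: "'a::real_vector \<Rightarrow> 'a"
  assumes "\<eta> \<in> Lambda_pq J 1 0"
  shows "(\<lambda>u. \<eta> (\<lambda>_. u)) \<in> forms10 J" "\<eta> v = \<eta> (\<lambda>_. v 0)"
proof -
  have "\<exists>\<alpha>\<in>forms10 J. \<forall>v. \<eta> v = \<alpha> (v 0)"
    using assms unfolding Lambda_pq_def
  proof (induction rule: cfun.span_induct)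
    case base
    let ?S = "{\<eta> :: (nat \<Rightarrow> 'a) \<Rightarrow> complex. \<exists>\<alpha>\<in>forms10 J. \<forall>v. \<eta> v = \<alpha> (v 0)}"
    show ?case
    proof (rule cfun.subspaceI)
      show "0 \<in> ?S"
        using cfun.subspace_0[OF forms10_subspace] by (auto intro!: bexI[of _ 0])
    next
      fix \<eta> \<xi> assume "\<eta> \<in> ?S" "\<xi> \<in> ?S"
      then obtain \<alpha> \<beta> where "\<alpha> \<in> forms10 J" "\<beta> \<in> forms10 J" "\<forall>v. \<eta> v = \<alpha> (v 0)" "\<forall>v. \<xi> v = \<beta> (v 0)" by auto
      then show "\<eta> + \<xi> \<in> ?S"
        using cfun.subspace_add[OF forms10_subspace] by (auto intro!: bexI[of _ "\<alpha> + \<beta>"])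
    next
      fix c \<eta> assume "\<eta> \<in> ?S"
      then obtain \<alpha> where "\<alpha> \<in> forms10 J" "\<forall>v. \<eta> v = \<alpha> (v 0)" by auto
      then show "(\<lambda>v. c * \<eta> v) \<in> ?S"
        using cfun.subspace_scale[OF forms10_subspace] by (auto intro!: bexI[of _ "\<lambda>x. c * \<alpha> x"])
    qed
  next
    case (step \<xi>)
    then obtain \<alpha> where "\<xi> = wedge 1 (\<lambda>i. if i < 1 then \<alpha> i else (\<lambda>v. cnj (\<alpha> i v)))" "\<alpha> 0 \<in> forms10 J"
      by auto
    then show ?case
      by (intro bexI[of _ "\<alpha> 0"]) (auto simp: wedge_eq_ndet ndet_first_row_free)
  qed
  then obtain \<alpha> where \<alpha>: "\<alpha> \<in> forms10 J" "\<And>v. \<eta> v = \<alpha> (v 0)" by blast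
  then show "(\<lambda>u. \<eta> (\<lambda>_. u)) \<in> forms10 J" "\<eta> v = \<eta> (\<lambda>_. v 0)" by simp_all
qed

section \<open>Invariant frames and the eigenvalue equations\<close>

context sy_structure
begin

abbreviation \<kappa> :: complex where "\<kappa> \<equiv> of_nat (k i\<^sub>1)"

abbreviation G :: "'n sy monoid" where "G \<equiv> sy_group N k"

lemma \<kappa>_nonzero: "\<kappa> \<noteq> 0"
  using k_pos[of i\<^sub>1] by simp

lemma invariant_bounded:
  assumes "\<And>x. f differentiable (at x)" "\<And>\<gamma> x. \<gamma> \<in> \<Gamma> \<Longrightarrow> f (\<gamma> \<otimes>\<^bsub>G\<^esub> x) = f x"
  shows "bounded (range (f :: 'n sy \<Rightarrow> complex))"
proof (rule lattice_invariant_bounded[OF lattice])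
  show "continuous_on UNIV f"
    by (simp add: assms(1) continuous_at_imp_continuous_on differentiable_imp_continuous_within)
  show "carrier G = UNIV" by (simp add: sy_group_def)
  show "\<one>\<^bsub>G\<^esub> \<otimes>\<^bsub>G\<^esub> x = x" for x by (cases x) (simp add: sy_group_def one_N)
qed (rule assms(2))

lemma G_mult: "(\<gamma>, \<gamma>1, \<gamma>2) \<otimes>\<^bsub>G\<^esub> (z, w1, w2) = (\<gamma> + z, \<gamma>1 \<cdot> scaling k \<gamma> w1, \<gamma>2 \<cdot> scaling k (- \<gamma>) w2)"
  by (simp add: sy_group_def)

lemma G_left_derivative:
  "frechet_derivative (\<lambda>q. (\<gamma>, \<gamma>1, \<gamma>2) \<otimes>\<^bsub>G\<^esub> q) (at (z, w1, w2)) (\<zeta>, u1, u2) =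
    (\<zeta>, D_left \<gamma>1 (scaling k \<gamma> w1) (scaling k \<gamma> u1), D_left \<gamma>2 (scaling k (- \<gamma>) w2) (scaling k (- \<gamma>) u2))"
proof -
  have fst_snd: "((\<lambda>q. fst (snd q)) has_derivative (\<lambda>v. fst (snd v))) (at x)"
    "((\<lambda>q. snd (snd q)) has_derivative (\<lambda>v. snd (snd v))) (at x)" for x :: "'n sy"
    by (auto intro!: derivative_eq_intros)
  note S = bounded_linear.has_derivative[OF bounded_linear_scaling]
  have "((\<lambda>q. (\<gamma> + fst q, \<gamma>1 \<cdot> scaling k \<gamma> (fst (snd q)), \<gamma>2 \<cdot> scaling k (- \<gamma>) (snd (snd q)))) has_derivative
    (\<lambda>v. (0 + fst v, D_left \<gamma>1 (scaling k \<gamma> (fst (snd (z, w1, w2)))) (scaling k \<gamma> (fst (snd v))),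
      D_left \<gamma>2 (scaling k (- \<gamma>) (snd (snd (z, w1, w2)))) (scaling k (- \<gamma>) (snd (snd v)))))) (at (z, w1, w2))"
    by (intro has_derivative_Pair has_derivative_add has_derivative_const has_derivative_fst has_derivative_ident
        has_derivative_compose[OF S[OF fst_snd(1)] left_mul_has_derivative]
        has_derivative_compose[OF S[OF fst_snd(2)] left_mul_has_derivative])
  moreover have "(\<lambda>q. (\<gamma>, \<gamma>1, \<gamma>2) \<otimes>\<^bsub>G\<^esub> q) =
      (\<lambda>q. (\<gamma> + fst q, \<gamma>1 \<cdot> scaling k \<gamma> (fst (snd q)), \<gamma>2 \<cdot> scaling k (- \<gamma>) (snd (snd q))))"
    by (auto simp: G_mult)
  ultimately show ?thesis by (simp add: frechet_derivative_at[symmetric])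
qed

text \<open>The left-invariant fields of G on the first copy, extending coordinate vectors rather
  than the vectors \<open>b j\<close>: at the identity they form the standard basis, and
  \<open>scaling_axis\<close> supplies the exponent that makes them invariant under G. In
  \<open>frame2\<close> the weight has the opposite sign.\<close>

definition frame1 :: "'n \<Rightarrow> 'n sy \<Rightarrow> 'n sy" where
  "frame1 j = (\<lambda>(z, w1, w2). (0, exp (of_nat (k j) * z) *s lif (axis j 1) w1, 0))"

definition frame2 :: "'n \<Rightarrow> 'n sy \<Rightarrow> 'n sy" where
  "frame2 j = (\<lambda>(z, w1, w2). (0, 0, exp (- of_nat (k j) * z) *s lif (axis j 1) w2))"

lemma frame_invariant:
  "frechet_derivative (\<lambda>q. \<gamma> \<otimes>\<^bsub>G\<^esub> q) (at x) (1, 0, 0) = (1, 0, 0)"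
  "frechet_derivative (\<lambda>q. \<gamma> \<otimes>\<^bsub>G\<^esub> q) (at x) (frame1 j x) = frame1 j (\<gamma> \<otimes>\<^bsub>G\<^esub> x)"
  "frechet_derivative (\<lambda>q. \<gamma> \<otimes>\<^bsub>G\<^esub> q) (at x) (frame2 j x) = frame2 j (\<gamma> \<otimes>\<^bsub>G\<^esub> x)"
proof -
  obtain \<gamma>0 \<gamma>1 \<gamma>2 z w1 w2 where "\<gamma> = (\<gamma>0, \<gamma>1, \<gamma>2)" "x = (z, w1, w2)" by (cases \<gamma>; cases x)
  then show "frechet_derivative (\<lambda>q. \<gamma> \<otimes>\<^bsub>G\<^esub> q) (at x) (1, 0, 0) = (1, 0, 0)"
    "frechet_derivative (\<lambda>q. \<gamma> \<otimes>\<^bsub>G\<^esub> q) (at x) (frame1 j x) = frame1 j (\<gamma> \<otimes>\<^bsub>G\<^esub> x)"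
    "frechet_derivative (\<lambda>q. \<gamma> \<otimes>\<^bsub>G\<^esub> q) (at x) (frame2 j x) = frame2 j (\<gamma> \<otimes>\<^bsub>G\<^esub> x)"
    by (simp_all add: G_left_derivative G_mult frame1_def frame2_def linear_0[OF linear_D_left] scaling_smult
        scaling_lif scaling_axis D_left_smult lif_smult lif_translate algebra_simps flip: exp_add)
qed

abbreviation Y :: "complex^'n \<Rightarrow> complex^'n" where "Y \<equiv> lif (b i\<^sub>1)"

lemma y_Y [simp]: "y w (Y w) = 1"
  by (simp add: y_def dual_form_lif)

lemma J_vertical: "J (z, w1, w2) (1, 0, 0) = (\<i>, 0, 0)"
  and J_Y: "J (z, w1, w2) (T z, 0, Y w2) = (- \<i> * T z, 0, \<i> *s Y w2)"
  by (simp_all add: J_simp y_simps)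

text \<open>For u = (T, 0, Y) the normalisation \<open>y_Y\<close> gives Ju = (-\<i> T, 0, \<i> Y),
  so u + \<i> J u is twice the sum of T times the z-derivative and the conjugate of Y. Together with
  the vertical vector this puts the equations into the form required by the Liouville
  argument.\<close>

lemma eigenfunction_vanishes:
  assumes diff: "\<And>x. f differentiable (at x)" and bdd: "bounded (range f)"
    and hol: "\<And>x. dbar J f x (1, 0, 0) = 0"
    and eq: "\<And>z w1 w2. dbar J f (z, w1, w2) (T z, 0, Y w2) = c * T z * f (z, w1, w2)"
    and c: "c \<noteq> 0"
  shows "f x = 0"
proof (rule bounded_eigenfunction_vanishes[OF diff bdd _ _ t c \<kappa>_nonzero])
  show "frechet_derivative f (at x) (\<i>, 0) = \<i> * frechet_derivative f (at x) (1, 0)" for x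
  proof -
    obtain z w1 w2 where "x = (z, w1, w2)" by (cases x)
    then have "\<i> * (frechet_derivative f (at x) (1, 0) + \<i> * frechet_derivative f (at x) (\<i>, 0)) = 0"
      using hol[of x] by (simp add: dbar_def J_vertical zero_prod_def)
    then show ?thesis by (simp add: algebra_simps)
  qed
  show "frechet_derivative f (at (z, w)) (t * exp (\<kappa> * z), (0, Y (snd w))) +
      \<i> * frechet_derivative f (at (z, w)) (- \<i> * t * exp (\<kappa> * z), (0, \<i> *s Y (snd w))) =
      c * (t * exp (\<kappa> * z)) * f (z, w)" for z w
    using eq[of z "fst w" "snd w", unfolded dbar_def J_Y, unfolded T_def]
    by (simp only: prod.collapse mult.assoc)
qed

text \<open>The factor T z' - T z vanishes at z' = z, so the product rule leaves only the derivative
  of T, which is \<kappa> T, times the undifferentiated \<open>F\<close>. The factor 2 arises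
  because u - \<i> J u for the vertical u is twice the z-derivative.\<close>

lemma del_vertical:
  assumes "E differentiable (at (z, w1, w2))" "F differentiable (at (z, w1, w2))"
    and eq: "\<And>z'. E (z', w1, w2) = c * (T z' - T z) * F (z', w1, w2)"
  shows "del J E (z, w1, w2) (1, 0, 0) = 2 * c * \<kappa> * T z * F (z, w1, w2)"
proof -
  let ?x = "(z, w1, w2)"
  have line: "((\<lambda>z'. H (z', w1, w2)) has_derivative (\<lambda>\<zeta>. frechet_derivative H (at ?x) (\<zeta>, 0, 0))) (at z)"
    if "H differentiable (at ?x)" for H :: "'n sy \<Rightarrow> complex"
    by (rule has_derivative_compose[where f = "\<lambda>z. (z, w1, w2)", OF _ differentiable_has_derivative[OF that]])
       (auto intro!: derivative_eq_intros simp: zero_prod_def)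
  have "((\<lambda>z'. c * (T z' - T z) * F (z', w1, w2)) has_derivative
      (\<lambda>\<zeta>. c * (\<kappa> * T z * \<zeta>) * F ?x)) (at z)"
    unfolding T_def by (auto intro!: derivative_eq_intros line assms(2) simp: algebra_simps)
  then have "(\<lambda>\<zeta>. frechet_derivative E (at ?x) (\<zeta>, 0, 0)) = (\<lambda>\<zeta>. c * (\<kappa> * T z * \<zeta>) * F ?x)"
    using has_derivative_unique[OF line[OF assms(1)]] by (simp add: eq)
  from fun_cong[OF this] show ?thesis
    by (simp add: del_def J_vertical algebra_simps)
qed

text \<open>The left-invariant field is holomorphic and \<open>pr\<close> is complex linear, so only
  the exponential contributes. The factor fst u + \<i> fst (J u) measures the failure of z to be
  holomorphic for J_t; it is 0 on the vertical vector and 2T on (T, 0, Y).\<close>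

lemma frame_component:
  fixes pr :: "'n sy \<Rightarrow> complex^'n"
  assumes pr: "bounded_linear pr" "\<And>x v. pr (J x v) = \<i> *s pr v"
  shows "(\<lambda>q. exp (c * fst q) * lif a (pr q) $ i) differentiable (at x)"
    and "dbar J (\<lambda>q. exp (c * fst q) * lif a (pr q) $ i) x u =
      c * (fst u + \<i> * fst (J x u)) * (exp (c * fst x) * lif a (pr x) $ i)"
proof -
  let ?D = "frechet_derivative (lif a) (at (pr x))"
  have lif: "(lif a has_derivative ?D) (at (pr x))"
    by (rule differentiable_has_derivative) (use lif_has_derivative differentiableI in blast)
  have "((\<lambda>q. lif a (pr q)) has_derivative (\<lambda>v. ?D (pr v))) (at x)"
    by (rule has_derivative_compose[OF bounded_linear_imp_has_derivative[OF pr(1)] lif])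
  then have lif_i: "((\<lambda>q. lif a (pr q) $ i) has_derivative (\<lambda>v. ?D (pr v) $ i)) (at x)"
    by (rule bounded_linear.has_derivative[OF bounded_linear_vec_nth])
  have "((\<lambda>q. c * fst q) has_derivative (\<lambda>v. c * fst v)) (at x)"
    by (auto intro!: derivative_eq_intros)
  from has_derivative_compose[OF this DERIV_exp[THEN has_field_derivative_imp_has_derivative]]
  have e: "((\<lambda>q. exp (c * fst q)) has_derivative (\<lambda>v. exp (c * fst x) * (c * fst v))) (at x)" .
  have D: "((\<lambda>q. exp (c * fst q) * lif a (pr q) $ i) has_derivative
      (\<lambda>v. exp (c * fst x) * (c * fst v * lif a (pr x) $ i + ?D (pr v) $ i))) (at x)"
    by (auto intro!: derivative_eq_intros lif_i e simp: algebra_simps)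
  then show "(\<lambda>q. exp (c * fst q) * lif a (pr q) $ i) differentiable (at x)"
    by (auto simp: differentiable_def)
  show "dbar J (\<lambda>q. exp (c * fst q) * lif a (pr q) $ i) x u =
      c * (fst u + \<i> * fst (J x u)) * (exp (c * fst x) * lif a (pr x) $ i)"
    by (simp add: dbar_def frechet_derivative_at[OF D, symmetric] pr(2) lif_holomorphic algebra_simps)
qed

text \<open>Here \<open>H i\<close> are the values of a form on constant vectors and
  \<open>f\<close> its value on an invariant field of weight c. Since \<open>dbar\<close>
  annihilates the former, the exponential turns \<open>f\<close> into an eigenfunction with constant
  2c.\<close>

lemma frame_coefficient_vanishes:
  fixes pr :: "'n sy \<Rightarrow> complex^'n"
  assumes pr: "bounded_linear pr" "\<And>x v. pr (J x v) = \<i> *s pr v"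
    and H: "\<And>i x. H i differentiable (at x)" "\<And>i x u. dbar J (H i) x u = 0"
    and f: "\<And>q. f q = (\<Sum>i\<in>UNIV. exp (c * fst q) * lif a (pr q) $ i * H i q)"
    and inv: "\<And>\<gamma> x. \<gamma> \<in> \<Gamma> \<Longrightarrow> f (\<gamma> \<otimes>\<^bsub>G\<^esub> x) = f x" and c: "c \<noteq> 0"
  shows "f x = 0"
proof -
  note comp = frame_component[OF pr, of c a]
  have prod: "(\<lambda>q. exp (c * fst q) * lif a (pr q) $ i * H i q) differentiable (at x)" for i x
    by (intro differentiable_mult comp H)
  have f': "f = (\<lambda>q. \<Sum>i\<in>UNIV. exp (c * fst q) * lif a (pr q) $ i * H i q)" by (rule ext) (rule f)
  have diff: "f differentiable (at x)" for x
    unfolding f' by (intro differentiable_sum prod ballI) simp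
  have eq: "dbar J f x u = c * (fst u + \<i> * fst (J x u)) * f x" for x u
  proof -
    have "dbar J (\<lambda>q. exp (c * fst q) * lif a (pr q) $ i * H i q) x u =
        c * (fst u + \<i> * fst (J x u)) * (exp (c * fst x) * lif a (pr x) $ i * H i x)" for i
      unfolding dbar_mult[OF comp(1) H(1)] comp(2) H(2) by simp
    then show ?thesis
      unfolding f' dbar_sum[OF finite prod] by (simp add: sum_distrib_left)
  qed
  show ?thesis
  proof (rule eigenfunction_vanishes[OF diff invariant_bounded[OF diff inv]])
    show "dbar J f x (1, 0, 0) = 0" for x
      by (cases x) (simp add: eq J_vertical)
    show "dbar J f (z, w1, w2) (T z, 0, Y w2) = 2 * c * T z * f (z, w1, w2)" for z w1 w2
      by (simp add: eq J_Y algebra_simps)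
  qed (use c in auto)
qed

end

section \<open>Forms of type (1,0)\<close>

context sy_structure
begin

lemma J_horizontal: "fst (snd (J x v)) = \<i> *s fst (snd v)" "snd (snd (J x v)) = \<i> *s snd (snd v)"
  by (simp_all add: J_def split_beta)

text \<open>The coefficient \<open>F\<close> of the deformed dz has to be eliminated before the
  others: it alone makes the values of the form on constant vectors non-holomorphic. Once it is
  gone, these values are annihilated by \<open>dbar\<close> and the invariant coefficients become
  eigenfunctions.\<close>

lemma holomorphic_1_form_vanishes:
  assumes \<omega>: "\<omega> \<in> dbar_cocycles G \<Gamma> J 1 0"
  shows "\<omega> = (\<lambda>x v. 0)"
proof -
  have pq: "\<omega> \<in> pq_forms G \<Gamma> J 1 0" using \<omega> dbar_cocycles_subset by blast
  define W where "W q u = \<omega> q (\<lambda>_. u)" for q u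
  have \<omega>_W: "\<omega> q v = W q (v 0)" for q v
    unfolding W_def by (rule type_1_0_form(2)[OF pq_forms_Lambda[OF pq]])
  have W: "W q \<in> forms10 (J q)" for q
    using type_1_0_form(1)[OF pq_forms_Lambda[OF pq]] by (simp add: W_def[abs_def])
  note lin = forms10D(1)[OF W] and W_J = forms10D(2)[OF W]
  have diff: "(\<lambda>q. W q u) differentiable (at x)" for u x
    unfolding W_def by (rule smooth_differentiable[OF pq_forms_smooth[OF pq]])
  have inv: "W (\<gamma> \<otimes>\<^bsub>G\<^esub> x) (frechet_derivative (\<lambda>q. \<gamma> \<otimes>\<^bsub>G\<^esub> q) (at x) u) = W x u"
    if "\<gamma> \<in> \<Gamma>" for \<gamma> x u
    unfolding W_def by (rule pq_forms_invariant[OF pq that])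
  have "Pow {..<1::nat} = {{}, {0}}" by auto
  then have compl: "complexified 1 (\<omega> q) a b = W q (a 0) + \<i> * W q (b 0)" for q a b
    by (simp add: complexified_def \<omega>_W)
  \<comment> \<open>On both sides \<open>J\<close> is frozen at x while q varies, so W q u + \<i> W
    q (J x u) vanishes at q = x but not around it.\<close>
  have closed: "dbar J (\<lambda>q. W q v - \<i> * W q (J x v)) x u = del J (\<lambda>q. W q u + \<i> * W q (J x u)) x v" for x u v
  proof -
    let ?a = "\<lambda>j::nat. if j = 0 then u else v" and ?b = "\<lambda>j::nat. if j = 0 then J x u else - J x v"
    have "dbar J (\<lambda>q. W q v + \<i> * W q (- J x v)) x u +
        (\<Sum>i = 1..1. (-1) ^ i * del J (\<lambda>q. W q (?a (skip i 0)) + \<i> * W q (?b (skip i 0))) x (?a i)) = 0"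
      using cocycle_contraction[OF \<omega>, of ?b x ?a] by (simp add: compl[unfolded One_nat_def] skip_def)
    then show ?thesis by (simp add: linear_neg[OF lin] skip_def)
  qed
  define F where "F q = W q (1, 0, 0)" for q
  have diff_F: "F differentiable (at x)" for x
    using diff by (simp add: F_def[abs_def])
  have W_vertical: "W q (\<zeta>, 0, 0) = \<zeta> * F q" for q \<zeta>
  proof -
    have "W q (\<i>, 0) = \<i> * W q (1, 0)"
      using W_J[of q "(1, 0, 0)"] by (cases q) (simp add: J_vertical zero_prod_def)
    from linear_complex_apply[OF lin this, of \<zeta>] show ?thesis
      unfolding F_def zero_prod_def .
  qed
  have F_0: "F x = 0" for x
  proof (rule eigenfunction_vanishes[OF diff_F])
    show "bounded (range F)"
      by (rule invariant_bounded[OF diff_F]) (metis F_def inv frame_invariant(1))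
    have W_\<i>: "W q (J x (1, 0, 0)) = \<i> * F q" for q x
      by (cases x) (simp add: J_vertical W_vertical)
    have dbar_F: "2 * dbar J F x u = del J (\<lambda>q. W q u + \<i> * W q (J x u)) x (1, 0, 0)" for x u
      using closed[where v = "(1, 0, 0)", of x u] dbar_cmult[OF diff_F, of J 2 x u]
      unfolding W_\<i> by (simp add: F_def algebra_simps)
    show "dbar J F x (1, 0, 0) = 0" for x
      using dbar_F[of x "(1, 0, 0)"] unfolding W_\<i> by (simp add: F_def del_def frechet_derivative_const)
    show "dbar J F (z, w1, w2) (T z, 0, Y w2) = (- 2 * \<kappa>) * T z * F (z, w1, w2)" for z w1 w2
    proof -
      let ?x = "(z, w1, w2)" and ?u = "(T z, 0, Y w2)"
      have line: "W (z', w1, w2) ?u + \<i> * W (z', w1, w2) (J ?x ?u) = - 2 * (T z' - T z) * F (z', w1, w2)" for z'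
      proof -
        let ?q = "(z', w1, w2)"
        \<comment> \<open>Freezing \<open>J\<close> at x instead of q shifts only the z-component,
          by the change of T, because y takes the value 1 on Y at the common w2.\<close>
        have "J ?x ?u = J ?q ?u + (2 * \<i> * (T z' - T z), 0, 0)"
          by (simp add: J_simp algebra_simps)
        then have eq: "W ?q (J ?x ?u) = \<i> * W ?q ?u + 2 * \<i> * (T z' - T z) * F ?q"
          by (simp only: linear_add[OF lin] W_J W_vertical)
        show ?thesis unfolding eq by (simp add: algebra_simps)
      qed
      have "(\<lambda>q. W q ?u + \<i> * W q (J ?x ?u)) differentiable (at ?x)"
        by (intro differentiable_add differentiable_mult diff differentiable_const)
      from del_vertical[OF this diff_F line]
      have "del J (\<lambda>q. W q ?u + \<i> * W q (J ?x ?u)) ?x (1, 0, 0) = 2 * (- 2) * \<kappa> * T z * F ?x"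
        by simp
      then show ?thesis using dbar_F[of ?x ?u] by simp
    qed
  qed (use \<kappa>_nonzero in simp)
  \<comment> \<open>Structures at different points differ only in the z-component of their values,
    and the form is now blind to that component.\<close>
  have W_J': "W q (J x v) = \<i> * W q v" for q x v
  proof -
    obtain \<zeta> u1 u2 where v: "v = (\<zeta>, u1, u2)" by (cases v)
    obtain \<xi> where "J x v = J q v + (\<xi>, 0, 0)"
      by (cases x; cases q) (auto simp: v J_simp intro: that[of "fst (J x v) - fst (J q v)"])
    then show ?thesis by (simp add: linear_add[OF lin] W_J W_vertical F_0)
  qed
  \<comment> \<open>The right side of \<open>closed\<close> is now the derivative of the zero
    function, while its left side is 2 \<open>dbar\<close> of W q v.\<close>
  have dbar_W: "dbar J (\<lambda>q. W q v) x u = 0" for v x u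
    using closed[of v x u] dbar_cmult[OF diff, of J 2 v x u]
    by (simp add: W_J' del_def frechet_derivative_const algebra_simps)
  have lin1: "linear (\<lambda>u. W q (0, u, 0))" "linear (\<lambda>u. W q (0, 0, u))" for q
    by (auto intro!: linear_compose[OF _ lin, unfolded o_def] linearI)
  have \<i>1: "W q (0, \<i> *s u, 0) = \<i> * W q (0, u, 0)" "W q (0, 0, \<i> *s u) = \<i> * W q (0, 0, u)" for q u
  proof -
    obtain z w1 w2 where q: "q = (z, w1, w2)" by (cases q)
    have "J q (0, u, 0) = (0, \<i> *s u, 0)"
      by (simp add: q J_simp y_simps)
    then show "W q (0, \<i> *s u, 0) = \<i> * W q (0, u, 0)" using W_J[of q "(0, u, 0)"] by metis
    \<comment> \<open>Multiplication by \<i> on the second copy is not \<open>J\<close>: the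
      deformation adds a vertical vector, on which the form vanishes by \<open>F_0\<close>.\<close>
    have "J q (0, 0, u) = (0, 0, \<i> *s u) + (- 2 * \<i> * T z * cnj (y w2 u), 0, 0)"
      by (simp add: q J_simp y_simps)
    then have "W q (J q (0, 0, u)) = W q (0, 0, \<i> *s u) + W q (- 2 * \<i> * T z * cnj (y w2 u), 0, 0)"
      by (simp only: linear_add[OF lin])
    then show "W q (0, 0, \<i> *s u) = \<i> * W q (0, 0, u)"
      by (simp only: W_J W_vertical F_0 mult_zero_right add_0_right)
  qed
  have "W q (frame1 j q) = 0" for j q
  proof (rule frame_coefficient_vanishes[where f = "\<lambda>q. W q (frame1 j q)" and pr = "\<lambda>q. fst (snd q)"
        and c = "of_nat (k j)" and a = "axis j 1" and H = "\<lambda>i q. W q (0, axis i 1, 0)"])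
    show "bounded_linear (\<lambda>q::'n sy. fst (snd q))"
      by (intro bounded_linear_intros)
    show "W q (frame1 j q) = (\<Sum>i\<in>UNIV. exp (of_nat (k j) * fst q) * lif (axis j 1) (fst (snd q)) $ i * W q (0, axis i 1, 0))" for q
    proof -
      have "frame1 j q = (0, exp (of_nat (k j) * fst q) *s lif (axis j 1) (fst (snd q)), 0)"
        by (simp add: frame1_def split_beta)
      then show ?thesis
        using linear_axis_expansion[OF lin1(1) \<i>1(1), of q "exp (of_nat (k j) * fst q) *s lif (axis j 1) (fst (snd q))"] by simp
    qed
  qed (use k_pos[of j] in \<open>auto simp: J_horizontal diff dbar_W inv frame_invariant(2)[symmetric]\<close>)
  moreover have "W q (frame2 j q) = 0" for j q
  proof (rule frame_coefficient_vanishes[where f = "\<lambda>q. W q (frame2 j q)" and pr = "\<lambda>q. snd (snd q)"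
        and c = "- of_nat (k j)" and a = "axis j 1" and H = "\<lambda>i q. W q (0, 0, axis i 1)"])
    show "bounded_linear (\<lambda>q::'n sy. snd (snd q))"
      by (intro bounded_linear_intros)
    show "W q (frame2 j q) = (\<Sum>i\<in>UNIV. exp (- of_nat (k j) * fst q) * lif (axis j 1) (snd (snd q)) $ i * W q (0, 0, axis i 1))" for q
    proof -
      have "frame2 j q = (0, 0, exp (- of_nat (k j) * fst q) *s lif (axis j 1) (snd (snd q)))"
        by (simp add: frame2_def split_beta)
      then show ?thesis
        using linear_axis_expansion[OF lin1(2) \<i>1(2), of q "exp (- of_nat (k j) * fst q) *s lif (axis j 1) (snd (snd q))"] by simp
    qed
  qed (use k_pos[of j] in \<open>auto simp: J_horizontal diff dbar_W inv frame_invariant(3)[symmetric]\<close>)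
  ultimately have frame_0: "W (z, w1, w2) (0, lif (axis j 1) w1, 0) = 0" "W (z, w1, w2) (0, 0, lif (axis j 1) w2) = 0"
    for j z w1 w2
    using complex_linearI[OF lin1(1) \<i>1(1), of "(z, w1, w2)" "exp (of_nat (k j) * z)" "lif (axis j 1) w1"]
      complex_linearI[OF lin1(2) \<i>1(2), of "(z, w1, w2)" "exp (- of_nat (k j) * z)" "lif (axis j 1) w2"]
    unfolding frame1_def frame2_def by (smt (verit) case_prod_conv exp_not_eq_zero mult_eq_0_iff)+
  have "W q v = 0" for q v
  proof -
    obtain z w1 w2 where q: "q = (z, w1, w2)" by (cases q)
    obtain \<zeta> v1 v2 where v: "v = (\<zeta>, v1, v2)" by (cases v)
    obtain u1 u2 where u: "v1 = lif u1 w1" "v2 = lif u2 w2" using lif_surj by metis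
    have expand: "L (lif u w) = (\<Sum>j\<in>UNIV. u $ j * L (lif (axis j 1) w))"
      if "linear L" "\<And>v. L (\<i> *s v) = \<i> * L v" for L :: "complex^'n \<Rightarrow> complex" and u w
      by (rule linear_axis_expansion)
        (simp_all add: linear_compose[OF lif_linear that(1), unfolded o_def] lif_smult that(2))
    have "W q (0, v1, 0) = 0" "W q (0, 0, v2) = 0"
      using expand[OF lin1(1) \<i>1(1), of q u1 w1] expand[OF lin1(2) \<i>1(2), of q u2 w2]
      by (simp_all add: u q frame_0)
    moreover have "W q v = W q (\<zeta>, 0, 0) + W q (0, v1, 0) + W q (0, 0, v2)"
      unfolding v by (simp flip: linear_add[OF lin])
    ultimately show ?thesis by (simp add: W_vertical F_0)
  qed
  then show ?thesis by (simp add: fun_eq_iff \<omega>_W)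
qed

end

section \<open>Forms of top holomorphic degree\<close>

lemma ndet_scale: "ndet n (\<lambda>i j. r i * M i j * c j) = (\<Prod>i<n. r i) * (\<Prod>i<n. c i) * ndet n M"
  unfolding ndet_def sum_distrib_left
proof (rule sum.cong[OF refl])
  fix \<sigma> assume "\<sigma> \<in> {\<sigma>. \<sigma> permutes {..<n}}"
  then have "(\<Prod>i<n. c (\<sigma> i)) = (\<Prod>i<n. c i)"
    using prod.permute[of \<sigma> "{..<n}" c] by (simp add: o_def)
  then show "of_int (sign \<sigma>) * (\<Prod>i<n. r i * M i (\<sigma> i) * c (\<sigma> i)) =
      (\<Prod>i<n. r i) * (\<Prod>i<n. c i) * (of_int (sign \<sigma>) * (\<Prod>i<n. M i (\<sigma> i)))"
    by (simp add: prod.distrib)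
qed

text \<open>A permutation moving 0 picks up one of the zeros below the top of column 0, so the
  entries of row 0 outside that column are irrelevant. This discards the T ybar entries from the
  matrix of the coframe on the frame.\<close>

lemma ndet_cong_first_column:
  assumes "0 < n" "M 0 0 = M' 0 0"
    and 0: "\<And>i. 0 < i \<Longrightarrow> i < n \<Longrightarrow> M i 0 = 0"
    and eq: "\<And>i j. 0 < i \<Longrightarrow> i < n \<Longrightarrow> j < n \<Longrightarrow> M i j = M' i j"
  shows "ndet n M = ndet n M'"
  unfolding ndet_def
proof (rule sum.cong[OF refl])
  fix \<sigma> assume "\<sigma> \<in> {\<sigma>. \<sigma> permutes {..<n}}"
  then have p: "\<sigma> permutes {..<n}" by simp
  then have lt: "\<sigma> i < n" if "i < n" for i using that permutes_in_image[OF p, of i] by simp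
  have "(\<Prod>i<n. M i (\<sigma> i)) = (\<Prod>i<n. M' i (\<sigma> i))"
  proof (cases "\<sigma> 0 = 0")
    case True
    then have "M i (\<sigma> i) = M' i (\<sigma> i)" if "i < n" for i
      using that assms(2) eq[of i "\<sigma> i"] lt by (cases "i = 0") auto
    then show ?thesis by (intro prod.cong) auto
  next
    case False
    define i where "i = inv_into UNIV \<sigma> 0"
    have i: "\<sigma> i = 0" "i < n"
      using permutes_inverses[OF p] permutes_in_image[OF permutes_inv[OF p], of 0] assms(1)
      by (auto simp: i_def)
    then have "0 < i" using False by (cases "i = 0") auto
    then have "M i (\<sigma> i) = 0" "M' i (\<sigma> i) = 0"
      using 0[of i] eq[of i 0] i assms(1) by auto
    then have "(\<Prod>i<n. M i (\<sigma> i)) = 0" "(\<Prod>i<n. M' i (\<sigma> i)) = 0"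
      using i(2) by (meson finite_lessThan lessThan_iff prod_zero)+
    then show ?thesis by (simp only:)
  qed
  then show "of_int (sign \<sigma>) * (\<Prod>i<n. M i (\<sigma> i)) = of_int (sign \<sigma>) * (\<Prod>i<n. M' i (\<sigma> i))" by simp
qed

lemma tendsto_ndet:
  assumes "\<And>i j. i < n \<Longrightarrow> j < n \<Longrightarrow> ((\<lambda>x. M x i j) \<longlongrightarrow> L i j) F"
  shows "((\<lambda>x. ndet n (M x)) \<longlongrightarrow> ndet n L) F"
  unfolding ndet_def
proof (intro tendsto_sum tendsto_mult tendsto_const tendsto_prod)
  fix \<sigma> i assume "\<sigma> \<in> {\<sigma>. \<sigma> permutes {..<n}}" "i \<in> {..<n}"
  then show "((\<lambda>x. M x i (\<sigma> i)) \<longlongrightarrow> L i (\<sigma> i)) F"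
    using permutes_in_image[of \<sigma> "{..<n}" i] by (intro assms) auto
qed

lemma sum_lessThan_odd:
  fixes m :: nat
  shows "(\<Sum>i<2 * m + 1. f i) = f 0 + (\<Sum>i = 1..m. f i) + (\<Sum>i = 1..m. f (i + m) :: 'a::comm_monoid_add)"
proof -
  have "{..<2 * m + 1} = insert 0 ({1..m} \<union> {1 + m..m + m})" by auto
  moreover have "sum f ({1..m} \<union> {1 + m..m + m}) = sum f {1..m} + sum f {1 + m..m + m}"
    by (rule sum.union_disjoint) auto
  moreover have "sum f {1 + m..m + m} = sum (\<lambda>i. f (i + m)) {1..m}"
    by (rule sum.shift_bounds_cl_nat_ivl)
  ultimately show ?thesis by (simp add: add.assoc)
qed

lemma prod_lessThan_odd:
  fixes m :: nat
  shows "(\<Prod>i<2 * m + 1. f i) = f 0 * (\<Prod>i = 1..m. f i) * (\<Prod>i = 1..m. f (i + m) :: 'a::comm_monoid_mult)"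
proof -
  have "{..<2 * m + 1} = insert 0 ({1..m} \<union> {1 + m..m + m})" by auto
  moreover have "prod f ({1..m} \<union> {1 + m..m + m}) = prod f {1..m} * prod f {1 + m..m + m}"
    by (rule prod.union_disjoint) auto
  moreover have "prod f {1 + m..m + m} = prod (\<lambda>i. f (i + m)) {1..m}"
    by (rule prod.shift_bounds_cl_nat_ivl)
  ultimately show ?thesis by (simp add: mult.assoc)
qed

section \<open>The coframe of the top form and the determinant of the invariant frame\<close>

locale sy_structure_enum = sy_structure N b k \<Gamma> i\<^sub>1 t
  for N :: "(complex^'n::finite) monoid" and b k \<Gamma> i\<^sub>1 t +
  fixes idx :: "nat \<Rightarrow> 'n" and m :: nat
  assumes idx: "bij_betw idx {1..m} UNIV"
begin

abbreviation n :: nat where "n \<equiv> 2 * m + 1"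

definition basis :: "nat \<Rightarrow> 'n sy" where
  "basis j = (if j = 0 then (1, 0, 0) else if j \<le> m then (0, axis (idx j) 1, 0) else (0, 0, axis (idx (j - m)) 1))"

text \<open>A basis of the (1,0)-forms at q in which only the entry 0 is deformed; the others are
  plain coordinate differentials. They do not vary with q and are complex linear for the structure
  at every point, which keeps the contractions of a top form triangular. Indices 1 to m belong to
  the first copy, m+1 to 2m to the second.\<close>

definition \<psi> :: "'n sy \<Rightarrow> nat \<Rightarrow> 'n sy \<Rightarrow> complex" where
  "\<psi> q i v = (if i = 0 then fst v - T (fst q) * cnj (y (snd (snd q)) (snd (snd v)))
    else if i \<le> m then fst (snd v) $ idx i else snd (snd v) $ idx (i - m))"

lemma idx_eq: "1 \<le> i \<Longrightarrow> i \<le> m \<Longrightarrow> 1 \<le> j \<Longrightarrow> j \<le> m \<Longrightarrow> idx i = idx j \<longleftrightarrow> i = j"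
  using inj_on_eq_iff[OF bij_betw_imp_inj_on[OF idx], of i j] by simp

lemma sum_idx: "(\<Sum>i\<in>UNIV. f i) = (\<Sum>j = 1..m. f (idx j))"
  using sum.reindex_bij_betw[OF idx, of f] by simp

lemma \<psi>_basis: "0 < i \<Longrightarrow> i < n \<Longrightarrow> j < n \<Longrightarrow> \<psi> q i (basis j) = (if i = j then 1 else 0)"
  by (auto simp: \<psi>_def basis_def axis_def idx_eq)

lemma \<psi>_0_basis_0: "\<psi> q 0 (basis 0) = 1"
  by (simp add: \<psi>_def basis_def y_simps)

lemma \<psi>_J: "0 < i \<Longrightarrow> \<psi> q i (J x v) = \<i> * \<psi> q i v"
  by (simp add: \<psi>_def J_horizontal)

lemma \<psi>_minus: "\<psi> q i (- v) = - \<psi> q i v"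
proof -
  have "y w (- u) = - y w u" for w u using y_simps(3)[of w "-1" u] by simp
  then show ?thesis by (simp add: \<psi>_def)
qed

lemma forms10_\<psi>_expansion:
  assumes "\<alpha> \<in> forms10 (J q)"
  obtains c where "\<And>v. \<alpha> v = (\<Sum>i<n. c i * \<psi> q i v)"
proof -
  obtain z w1 w2 where q: "q = (z, w1, w2)" by (cases q)
  obtain c A B where \<alpha>: "\<And>\<zeta> u1 u2. \<alpha> (\<zeta>, u1, u2) = c * (\<zeta> - T z * cnj (y w2 u2)) + A u1 + B u2"
    and A: "linear A" "\<And>c u. A (c *s u) = c * A u" and B: "linear B" "\<And>c u. B (c *s u) = c * B u"
    using forms10_J_expansion[OF assms[unfolded q]] by metis
  define d where "d i = (if i = 0 then c else if i \<le> m then A (axis (idx i) 1) else B (axis (idx (i - m)) 1))" for i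
  have "\<alpha> v = (\<Sum>i<n. d i * \<psi> q i v)" for v
  proof -
    obtain \<zeta> u1 u2 where v: "v = (\<zeta>, u1, u2)" by (cases v)
    have "A u1 = (\<Sum>i = 1..m. d i * \<psi> q i v)"
      unfolding linear_axis_expansion[OF A(1) A(2), of u1] sum_idx
      by (intro sum.cong refl) (auto simp: d_def \<psi>_def v)
    moreover have "B u2 = (\<Sum>i = 1..m. d (i + m) * \<psi> q (i + m) v)"
      unfolding linear_axis_expansion[OF B(1) B(2), of u2] sum_idx
      by (intro sum.cong refl) (auto simp: d_def \<psi>_def v)
    moreover have "c * (\<zeta> - T z * cnj (y w2 u2)) = d 0 * \<psi> q 0 v"
      by (simp add: d_def \<psi>_def v q)
    ultimately show ?thesis unfolding sum_lessThan_odd v \<alpha> by simp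
  qed
  then show ?thesis by (rule that)
qed

lemma ndet_\<psi>_basis: "ndet n (\<lambda>i j. \<psi> q i (basis j)) = 1"
proof -
  have "ndet n (\<lambda>i j. \<psi> q i (basis j)) = (\<Prod>i<n. \<psi> q i (basis i))"
    by (rule ndet_first_row_free) (simp add: \<psi>_basis)
  also have "\<dots> = 1"
  proof (rule prod.neutral, intro ballI)
    fix i assume "i \<in> {..<n}"
    then show "\<psi> q i (basis i) = 1" using \<psi>_basis[of i i q] \<psi>_0_basis_0 by (cases "i = 0") auto
  qed
  finally show ?thesis .
qed

text \<open>Writing the (1,0)-factors of a generator in the \<psi>-basis turns its matrix into a
  product, so \<open>ndet_mult\<close> splits off the determinant of the coefficients. That constant
  is recovered by evaluating on \<open>basis\<close>, where the \<psi>-determinant is 1.\<close>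

lemma top_form:
  assumes "\<eta> \<in> Lambda_pq (J q) n 0"
  shows "\<eta> v = \<eta> basis * ndet n (\<lambda>i j. \<psi> q i (v j))"
  using assms unfolding Lambda_pq_def
proof (induction rule: cfun.span_induct)
  case base
  let ?d = "ndet n (\<lambda>i j. \<psi> q i (v j))"
  show ?case
  proof (rule cfun.subspaceI)
    show "0 \<in> {\<eta>. \<eta> v = \<eta> basis * ?d}" by simp
    show "\<eta> + \<xi> \<in> {\<eta>. \<eta> v = \<eta> basis * ?d}"
      if "\<eta> \<in> {\<eta>. \<eta> v = \<eta> basis * ?d}" "\<xi> \<in> {\<eta>. \<eta> v = \<eta> basis * ?d}" for \<eta> \<xi>
      using that unfolding mem_Collect_eq plus_fun_apply ring_distribs by (rule arg_cong2[where f="(+)"])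
    show "(\<lambda>v. c * \<eta> v) \<in> {\<eta>. \<eta> v = \<eta> basis * ?d}"
      if "\<eta> \<in> {\<eta>. \<eta> v = \<eta> basis * ?d}" for c \<eta>
      using that unfolding mem_Collect_eq mult.assoc by (rule arg_cong)
  qed
next
  case (step \<xi>)
  then obtain \<alpha> where \<xi>: "\<xi> = wedge n (\<lambda>i. if i < n then \<alpha> i else (\<lambda>v. cnj (\<alpha> i v)))"
    and \<alpha>: "\<And>i. i < n \<Longrightarrow> \<alpha> i \<in> forms10 (J q)"
    by auto
  have "\<exists>c. \<forall>v. i < n \<longrightarrow> \<alpha> i v = (\<Sum>l<n. c l * \<psi> q l v)" for i
    using forms10_\<psi>_expansion[OF \<alpha>] by metis
  then obtain c where c: "\<And>i v. i < n \<Longrightarrow> \<alpha> i v = (\<Sum>l<n. c i l * \<psi> q l v)" by metis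
  have \<xi>_ndet: "\<xi> v = ndet n c * ndet n (\<lambda>i j. \<psi> q i (v j))" for v
    unfolding \<xi> wedge_eq_ndet ndet_mult[symmetric] by (rule ndet_cong) (simp add: c)
  show ?case unfolding \<xi>_ndet ndet_\<psi>_basis by simp
qed

definition frame :: "'n sy \<Rightarrow> nat \<Rightarrow> 'n sy" where
  "frame q j = (if j = 0 then (1, 0, 0) else if j \<le> m then frame1 (idx j) q else frame2 (idx (j - m)) q)"

text \<open>The coordinates of the left-invariant fields of N on each copy, without the exponentials
  in z, as two diagonal blocks bordered by a 1 for the z-direction.\<close>

definition coord_matrix :: "complex^'n \<Rightarrow> complex^'n \<Rightarrow> nat \<Rightarrow> nat \<Rightarrow> complex" where
  "coord_matrix w1 w2 i j = (if i = 0 \<or> j = 0 then if i = j then 1 else 0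
    else if i \<le> m \<and> j \<le> m then lif (axis (idx j) 1) w1 $ idx i
    else if m < i \<and> m < j then lif (axis (idx (j - m)) 1) w2 $ idx (i - m) else 0)"

lemma coord_matrix_0:
  assumes "i < n" "j < n"
  shows "coord_matrix 0 0 i j = (if i = j then 1 else 0)"
  using assms by (auto simp: coord_matrix_def axis_def idx_eq)

lemma scaling_tendsto_0: "(\<lambda>p. scaling k (- of_nat p) w) \<longlonglongrightarrow> 0"
proof (rule vec_tendstoI)
  fix i
  have "norm (exp (- of_nat (k i) :: complex)) < 1" using k_pos[of i] by simp
  then have "(\<lambda>p. exp (- of_nat (k i) :: complex) ^ p * w $ i) \<longlonglongrightarrow> 0 * w $ i"
    by (intro tendsto_mult tendsto_const LIMSEQ_power_zero)
  moreover have "exp (- of_nat (k i) :: complex) ^ p = exp (of_nat (k i) * - of_nat p)" for p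
    by (simp add: mult.commute flip: exp_of_nat_mult)
  ultimately show "(\<lambda>p. scaling k (- of_nat p) w $ i) \<longlonglongrightarrow> 0 $ i"
    by (simp add: scaling_def)
qed

text \<open>The scaling automorphisms conjugate the matrix by a diagonal one and contract the group to the
  identity, where the frame is the standard basis.\<close>

lemma ndet_coord_matrix: "ndet n (coord_matrix w1 w2) = 1"
proof -
  define r where "r s i = (if i = 0 then 1 else exp (of_nat (k (idx (if i \<le> m then i else i - m))) * s))"
    for s :: complex and i
  have r_nz: "r s i \<noteq> 0" for s i by (simp add: r_def)
  have invariant: "ndet n (coord_matrix (scaling k s w1) (scaling k s w2)) = ndet n (coord_matrix w1 w2)" for s
  proof -
    have "coord_matrix (scaling k s w1) (scaling k s w2) = (\<lambda>i j. r s i * coord_matrix w1 w2 i j * inverse (r s j))"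
      by (intro ext) (auto simp: coord_matrix_def r_def lif_scaling exp_minus scaling_def[where w = "lif _ _"])
    then have "ndet n (coord_matrix (scaling k s w1) (scaling k s w2)) =
        (\<Prod>i<n. r s i) * (\<Prod>i<n. inverse (r s i)) * ndet n (coord_matrix w1 w2)"
      by (simp only: ndet_scale)
    moreover have "(\<Prod>i<n. r s i) * (\<Prod>i<n. inverse (r s i)) = 1"
      unfolding prod.distrib[symmetric] by (rule prod.neutral) (simp add: r_nz)
    ultimately show ?thesis by simp
  qed
  have lif_cont: "(\<lambda>p. lif u (scaling k (- of_nat p) w) $ i) \<longlonglongrightarrow> lif u 0 $ i" for u w i
  proof -
    have "isCont (lif u) 0" by (rule has_derivative_continuous[OF lif_has_derivative])
    from isCont_tendsto_compose[OF this scaling_tendsto_0] show ?thesis by (rule tendsto_vec_nth)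
  qed
  have "(\<lambda>p. ndet n (coord_matrix (scaling k (- of_nat p) w1) (scaling k (- of_nat p) w2)))
      \<longlonglongrightarrow> ndet n (coord_matrix 0 0)"
    by (rule tendsto_ndet) (unfold coord_matrix_def, auto intro: lif_cont simp del: lif_at_0)
  then have "ndet n (coord_matrix w1 w2) = ndet n (coord_matrix 0 0)"
    unfolding invariant by (simp add: LIMSEQ_const_iff)
  also have "\<dots> = (\<Prod>i<n. coord_matrix 0 0 i i)"
    by (rule ndet_first_row_free) (simp add: coord_matrix_0)
  also have "\<dots> = 1" by (rule prod.neutral) (simp add: coord_matrix_0)
  finally show ?thesis .
qed

text \<open>The weights on the two copies are opposite, so the exponentials cancel in pairs and the
  determinant of the coordinate matrix remains.\<close>

lemma ndet_\<psi>_frame: "ndet n (\<lambda>i j. \<psi> q i (frame q j)) = 1"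
proof -
  obtain z w1 w2 where q: "q = (z, w1, w2)" by (cases q)
  define c where "c j = (if j = 0 then 1 else if j \<le> m then exp (of_nat (k (idx j)) * z)
    else exp (- of_nat (k (idx (j - m))) * z))" for j
  have "ndet n (\<lambda>i j. \<psi> q i (frame q j)) = ndet n (\<lambda>i j. 1 * coord_matrix w1 w2 i j * c j)"
    by (rule ndet_cong_first_column)
       (auto simp: \<psi>_def frame_def coord_matrix_def c_def q frame1_def frame2_def y_simps)
  also have "\<dots> = (\<Prod>i<n. c i)"
    unfolding ndet_scale ndet_coord_matrix by simp
  also have "\<dots> = 1"
    unfolding prod_lessThan_odd by (simp add: c_def exp_minus prod_inversef[unfolded o_def])
  finally show ?thesis .
qed

lemma frame_pushforward:
  "frechet_derivative (\<lambda>q. \<gamma> \<otimes>\<^bsub>G\<^esub> q) (at x) (frame x j) = frame (\<gamma> \<otimes>\<^bsub>G\<^esub> x) j"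
  by (simp add: frame_def frame_invariant)

text \<open>The contraction uses an arbitrary u and the full constant basis. Only omitting u or the
  vertical vector leaves a nonzero determinant, so the cocycle condition reduces to one relation
  between \<open>dbar\<close> of the coefficient h and the vertical derivative of h times the value
  of \<psi> 0 on u + \<i> J u.\<close>

lemma holomorphic_top_form_vanishes:
  assumes \<omega>: "\<omega> \<in> dbar_cocycles G \<Gamma> J n 0"
  shows "\<omega> = (\<lambda>x v. 0)"
proof -
  have pq: "\<omega> \<in> pq_forms G \<Gamma> J n 0" using \<omega> dbar_cocycles_subset by blast
  define h where "h q = \<omega> q basis" for q
  have \<omega>_h: "\<omega> q v = h q * ndet n (\<lambda>i j. \<psi> q i (v j))" for q v
    unfolding h_def by (rule top_form[OF pq_forms_Lambda[OF pq]])
  then have \<omega>_wedge: "\<omega> q = (\<lambda>v. h q * wedge n (\<psi> q) v)" for q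
    by (simp add: fun_eq_iff wedge_eq_ndet)
  have diff: "(\<lambda>q. \<omega> q v) differentiable (at x)" for v x
    by (rule smooth_differentiable[OF pq_forms_smooth[OF pq]])
  have diff_h: "h differentiable (at x)" for x
    using diff by (simp add: h_def[abs_def])
  \<comment> \<open>By definition h is the value on constant vectors; unimodularity of the frame
    identifies it with the value on the invariant frame, so h is invariant under the
    lattice.\<close>
  have h_frame: "h q = \<omega> q (frame q)" for q
    by (simp only: \<omega>_h ndet_\<psi>_frame mult_1_right)
  have bdd: "bounded (range h)"
  proof (rule invariant_bounded[OF diff_h])
    fix \<gamma> x assume "\<gamma> \<in> \<Gamma>"
    from pq_forms_invariant[OF pq this, of x "frame x"]
    show "h (\<gamma> \<otimes>\<^bsub>G\<^esub> x) = h x" by (simp add: frame_pushforward h_frame)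
  qed
  have compl: "complexified n (\<omega> q) a b = h q * ndet n (\<lambda>i j. \<psi> q i (a j) + \<i> * \<psi> q i (b j))" for q a b
    by (simp only: \<omega>_wedge complexified_scale complexified_wedge)
  have closed: "2 ^ n * dbar J h x u =
      del J (\<lambda>q. 2 ^ (2 * m) * h q * (\<psi> q 0 u + \<i> * \<psi> q 0 (J x u))) x (1, 0, 0)"
    and diff_R: "(\<lambda>q. 2 ^ (2 * m) * h q * (\<psi> q 0 u + \<i> * \<psi> q 0 (J x u))) differentiable (at p)" for x u p
  proof -
    \<comment> \<open>Slot 0 holds u, which shifts the basis by one: omitting slot l \<ge> 1 removes
      the basis vector l - 1.\<close>
    define a where "a j = (if j = 0 then u else basis (j - 1))" for j
    define b where "b j = (if j = 0 then J x u else - J x (basis (j - 1)))" for j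
    define M where "M l q i j = \<psi> q i (a (skip l j)) + \<i> * \<psi> q i (b (skip l j))" for l q i j
    define F where "F l q = complexified n (\<omega> q) (a \<circ> skip l) (b \<circ> skip l)" for l q
    have F: "F l q = h q * ndet n (M l q)" for l q
      unfolding F_def compl by (simp only: M_def[abs_def] o_def)
    have zero: "\<psi> q i u + \<i> * \<psi> q i (J x u) = 0" if "0 < i" for q i
      using that by (simp add: \<psi>_def J_horizontal)
    have two: "\<psi> q i (basis j) - \<i> * \<psi> q i (J x (basis j)) = (if i = j then 2 else 0)"
      if "0 < i" "i < n" "j < n" for q i j
      using that by (simp add: \<psi>_basis \<psi>_J)
    have two_0: "\<psi> q 0 (basis 0) - \<i> * \<psi> q 0 (J x (basis 0)) = 2" for q
      by (cases x) (simp add: \<psi>_def basis_def J_vertical y_simps)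
    have two_diag: "\<psi> q i (basis i) - \<i> * \<psi> q i (J x (basis i)) = 2" if "i < n" for q i
      using two[of i i q] two_0[of q] that by (cases "i = 0") auto
    have prod_2: "(\<Prod>i<n. if i = 0 then c else 2) = c * 2 ^ (2 * m)" for c :: complex
    proof -
      have "(\<Prod>i<n. if i = 0 then c else 2) = c * (\<Prod>i\<in>{..<n} - {0}. if i = 0 then c else 2)"
        by (subst prod.remove[of _ 0]) auto
      also have "(\<Prod>i\<in>{..<n} - {0}. if i = 0 then c else 2) = (\<Prod>i\<in>{..<n} - {0}. 2)"
        by (rule prod.cong) auto
      finally show ?thesis by simp
    qed
    have F0: "F 0 q = 2 ^ n * h q" for q
    proof -
      have "ndet n (M 0 q) = (\<Prod>i<n. M 0 q i i)"
        by (rule ndet_first_row_free) (simp add: M_def a_def b_def skip_def \<psi>_minus two)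
      also have "\<dots> = (\<Prod>i<n. if i = 0 then 2 else 2)"
        by (intro prod.cong refl) (auto simp: M_def a_def b_def skip_def \<psi>_minus two_diag)
      finally show ?thesis unfolding F prod_2 by simp
    qed
    have F1: "F 1 q = 2 ^ (2 * m) * h q * (\<psi> q 0 u + \<i> * \<psi> q 0 (J x u))" for q
    proof -
      have "ndet n (M 1 q) = (\<Prod>i<n. M 1 q i i)"
        by (rule ndet_first_row_free) (auto simp: M_def a_def b_def skip_def \<psi>_minus two zero)
      also have "\<dots> = (\<Prod>i<n. if i = 0 then \<psi> q 0 u + \<i> * \<psi> q 0 (J x u) else 2)"
        by (intro prod.cong refl) (auto simp: M_def a_def b_def skip_def \<psi>_minus two)
      finally show ?thesis unfolding F prod_2 by simp
    qed
    \<comment> \<open>The row l - 1 is zero: its differential vanishes on u + \<i> J u, and the only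
      basis vector on which it does not vanish is the omitted one.\<close>
    have F_zero: "F l q = 0" if l: "2 \<le> l" "l \<le> n" for l q
    proof -
      have "M l q (l - 1) j = 0" if "j < n" for j
        using that l zero[of "l - 1" q] two[of "l - 1" "j - 1" q] two[of "l - 1" j q]
        by (cases "j = 0"; cases "j < l") (auto simp: M_def a_def b_def skip_def \<psi>_minus)
      then have "ndet n (M l q) = 0"
        using l permutes_in_image[of _ "{..<n}" "l - 1"] by (intro ndet_eq_0 exI[of _ "l - 1"]) simp
      then show ?thesis by (simp add: F)
    qed
    show "(\<lambda>q. 2 ^ (2 * m) * h q * (\<psi> q 0 u + \<i> * \<psi> q 0 (J x u))) differentiable (at p)"
      unfolding F1[symmetric] F_def complexified_def
      by (intro differentiable_sum differentiable_mult differentiable_const diff ballI) simp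
    have "dbar J (F 0) x (a 0) + (\<Sum>i = 1..n. (-1)^i * del J (F i) x (a i)) = 0"
      unfolding F_def[abs_def] by (rule cocycle_contraction[OF \<omega>]) (auto simp: a_def b_def)
    moreover have "(\<Sum>i = 1..n. (-1)^i * del J (F i) x (a i)) = - del J (F 1) x (a 1)"
    proof -
      have "(\<Sum>i = 1..n. (-1)^i * del J (F i) x (a i)) = (\<Sum>i\<in>{1}. (-1)^i * del J (F i) x (a i))"
      proof (rule sum.mono_neutral_right)
        show "\<forall>i\<in>{1..n} - {1}. (-1)^i * del J (F i) x (a i) = 0"
        proof
          fix i assume "i \<in> {1..n} - {1}"
          then have "F i = (\<lambda>q. 0)" by (intro ext F_zero) auto
          then show "(-1)^i * del J (F i) x (a i) = 0"
            by (simp add: del_def frechet_derivative_const)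
        qed
      qed auto
      then show ?thesis by simp
    qed
    ultimately have "dbar J (F 0) x u = del J (F 1) x (1, 0, 0)"
      by (simp add: a_def basis_def)
    moreover have "dbar J (F 0) x u = 2 ^ n * dbar J h x u"
      unfolding F0[abs_def] by (rule dbar_cmult[OF diff_h])
    ultimately show "2 ^ n * dbar J h x u =
        del J (\<lambda>q. 2 ^ (2 * m) * h q * (\<psi> q 0 u + \<i> * \<psi> q 0 (J x u))) x (1, 0, 0)"
      unfolding F1[abs_def] by simp
  qed
  have "h x = 0" for x
  proof (rule eigenfunction_vanishes[OF diff_h bdd])
    show "dbar J h x (1, 0, 0) = 0" for x
    proof -
      have "\<psi> q 0 (1, 0, 0) + \<i> * \<psi> q 0 (J x (1, 0, 0)) = 0" for q
        by (cases x) (simp add: \<psi>_def J_vertical y_simps)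
      then have "2 ^ n * dbar J h x (1, 0, 0) = 0"
        unfolding closed by (simp add: del_def frechet_derivative_const)
      then show ?thesis by simp
    qed
    show "dbar J h (z, w1, w2) (T z, 0, Y w2) = (- 2 * \<kappa>) * T z * h (z, w1, w2)" for z w1 w2
    proof -
      let ?x = "(z, w1, w2)" and ?u = "(T z, 0, Y w2)"
      \<comment> \<open>Evaluated at z' with \<open>J\<close> frozen at z, the form \<psi> 0 gives
        2(T z - T z') on u + \<i> J u; this 2 joins the 2^(2m) to make 2^n.\<close>
      have line: "2 ^ (2 * m) * h (z', w1, w2) * (\<psi> (z', w1, w2) 0 ?u + \<i> * \<psi> (z', w1, w2) 0 (J ?x ?u)) =
          (- (2 ^ n)) * (T z' - T z) * h (z', w1, w2)" for z'
        unfolding J_Y by (simp add: \<psi>_def y_simps algebra_simps)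
      have "2 ^ n * dbar J h ?x ?u = 2 * (- (2 ^ n)) * \<kappa> * T z * h ?x"
        unfolding closed by (rule del_vertical[OF diff_R diff_h line])
      then have "2 ^ n * dbar J h ?x ?u = 2 ^ n * ((- 2 * \<kappa>) * T z * h ?x)" by simp
      then show ?thesis by (subst (asm) mult_cancel_left) simp
    qed
  qed (use \<kappa>_nonzero in simp)
  then show ?thesis by (simp add: fun_eq_iff \<omega>_h)
qed

end

theorem proposition5p1:
  fixes C :: "'n::finite \<Rightarrow> 'n \<Rightarrow> 'n \<Rightarrow> int"
    and idx :: "nat \<Rightarrow> 'n"
    and l m :: nat
    and k :: "'n \<Rightarrow> nat"
    and N :: "(complex^'n) monoid"
    and b :: "'n \<Rightarrow> complex^'n"
    and B\<^sub>0 :: "int^2^2"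
    and lam :: real
  assumes enum: "bij_betw idx {1..m} UNIV" "1 \<le> l" "l \<le> m"
    and n_lie: "lie_bracket (n_bracket C)" "nilpotent_bracket (n_bracket C)"
    and n_derived: "derived_algebra (n_bracket C) = vec.span ((\<lambda>i. axis (idx i) 1) ` {l+1..m})"
    and k_pos: "\<And>j. 0 < k j"
    and g_lie: "lie_bracket (g_bracket C k)"
    and N_group: "complex_lie_group N" "has_lie_algebra N b C"
    and action: "\<And>z. scaling k z \<in> hom N N"
      "\<And>z j. frechet_derivative (scaling k z) (at \<one>\<^bsub>N\<^esub>) (b j) = exp (of_nat (k j) * z) *s b j"
    and B\<^sub>0: "det B\<^sub>0 = 1" "is_eigenvalue B\<^sub>0 lam" "is_eigenvalue B\<^sub>0 (inverse lam)"
      "0 < lam" "lam \<noteq> inverse lam"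
    and \<Gamma>_lattice: "lattice_in (sy_lattice lam) (sy_group N k)"
  shows "\<exists>\<epsilon>>0. \<forall>t::complex. t \<noteq> 0 \<and> cmod t < \<epsilon> \<longrightarrow>
      dolbeault_dim (sy_group N k) (sy_lattice lam) (sy_complex_structure N b k (idx 1) t) 1 0 = 0 \<and>
      dolbeault_dim (sy_group N k) (sy_lattice lam) (sy_complex_structure N b k (idx 1) t) (2 * m + 1) 0 = 0"
\<comment> \<open>The radius 1 serves as witness: the explicit \<open>J\<close> is available for
  every t, and both vanishing lemmas hold for each nonzero t.\<close>
proof (intro exI[of _ 1] conjI allI impI)
  fix t :: complex assume "t \<noteq> 0 \<and> cmod t < 1"
  then have t: "t \<noteq> 0" by simp
  interpret sy_structure_enum N b k "sy_lattice lam" "idx 1" t idx m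
    \<comment> \<open>Since \<open>scaling k z\<close> is linear, it is its own derivative at the
      identity; this turns the infinitesimal action into \<open>scaling_b\<close>.\<close>
    using N_group k_pos action \<Gamma>_lattice enum t
    by unfold_locales (auto simp: has_lie_algebra_def)
  show "dolbeault_dim (sy_group N k) (sy_lattice lam) (sy_complex_structure N b k (idx 1) t) 1 0 = 0"
    \<comment> \<open>For q = 0 the coboundaries consist of the zero form alone, so the dimension is
      0 as soon as every cocycle vanishes.\<close>
    unfolding dolbeault_dim_def dbar_coboundaries_def sy_complex_structure_eq nat.case
    by (rule quotient_dim_eq_0[OF holomorphic_1_form_vanishes])
  show "dolbeault_dim (sy_group N k) (sy_lattice lam) (sy_complex_structure N b k (idx 1) t) (2 * m + 1) 0 = 0"
    unfolding dolbeault_dim_def dbar_coboundaries_def sy_complex_structure_eq nat.case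
    by (rule quotient_dim_eq_0[OF holomorphic_top_form_vanishes])
qed simp

end
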